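(* Let $\Omega$ be a bounded domain in $\mathbb{R}^{2n}$. Let $H\in L^\infty(\Omega)$ and let $\vec F\in W^{1,2}(\Omega)$ be a vector field satisfying $\operatorname{div}\vec F^{\ast}>0$ (a.e.) in $\Omega$. Let $u,v\in W^{1,2}(\Omega)$ be two minimizers for $\mathcal{F}(u)=\int_\Omega\{|\nabla u+\vec F|+Hu\}$ such that $u-v\in W^{1,2}_0(\Omega)$. Then $u\equiv v$ in $\Omega$ (a.e.).
   Context: Integrals are with respect to Lebesgue measure. A function $u\in W^{1,1}(\Omega)$ is called a minimizer for $\mathcal{F}(u)=\int_\Omega\{|\nabla u+\vec F|+Hu\}$ (where $\vec F\in L^1(\Omega)$ and $H\in L^\infty(\Omega)$) if $\mathcal{F}(u)\le\mathcal{F}(u+\varphi)$ for every $\varphi\in W^{1,1}_0(\Omega)$. For a vector field $\vec G=(g_1,g_2,\dots,g_{2n})$ on $\Omega\subset\mathbb{R}^{2n}$, set $\vec G^{\ast}=(g_2,-g_1,g_4,-g_3,\dots,g_{2n},-g_{2n-1})$. *)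

theory Defs
  imports "HOL-Analysis.Analysis"
begin

primrec Ck :: "nat \<Rightarrow> ('a::euclidean_space \<Rightarrow> real) \<Rightarrow> bool" where
  "Ck 0 f \<longleftrightarrow> continuous_on UNIV f"
| "Ck (Suc k) f \<longleftrightarrow> (\<forall>x. f differentiable (at x)) \<and>
     (\<forall>i\<in>Basis. Ck k (\<lambda>x. frechet_derivative f (at x) i))"

text \<open>The space \<open>C\<^sub>c\<^sup>\<infinity>(\<Omega>)\<close>; its members are extended by zero to the whole space.\<close>

definition test_functions :: "'a::euclidean_space set \<Rightarrow> ('a \<Rightarrow> real) set" where
  "test_functions \<Omega> = {\<phi>. (\<forall>k. Ck k \<phi>) \<and>
     compact (closure {x. \<phi> x \<noteq> 0}) \<and> closure {x. \<phi> x \<noteq> 0} \<subseteq> \<Omega>}"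

text \<open>
  Elements of the function spaces below are functions on the whole space of which only the
  restriction to \<open>\<Omega>\<close> matters. They are not identified when they agree almost everywhere.
  The exponent \<open>p\<close> is meant to satisfy \<open>1 \<le> p < \<infinity>\<close>.
\<close>

definition Lp :: "real \<Rightarrow> 'a::euclidean_space set \<Rightarrow> ('a \<Rightarrow> real) set" where
  "Lp p \<Omega> = {f. f \<in> borel_measurable (lebesgue_on \<Omega>) \<and>
     integrable (lebesgue_on \<Omega>) (\<lambda>x. \<bar>f x\<bar> powr p)}"

definition Linf :: "'a::euclidean_space set \<Rightarrow> ('a \<Rightarrow> real) set" where
  "Linf \<Omega> = {f. f \<in> borel_measurable (lebesgue_on \<Omega>) \<and>
     (\<exists>C. AE x in lebesgue_on \<Omega>. \<bar>f x\<bar> \<le> C)}"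

definition L1_loc :: "'a::euclidean_space set \<Rightarrow> ('a \<Rightarrow> real) set" where
  "L1_loc \<Omega> = {f. \<forall>K. compact K \<and> K \<subseteq> \<Omega> \<longrightarrow> integrable (lebesgue_on K) f}"

definition has_weak_partial ::
    "'a::euclidean_space set \<Rightarrow> 'a \<Rightarrow> ('a \<Rightarrow> real) \<Rightarrow> ('a \<Rightarrow> real) \<Rightarrow> bool" where
  "has_weak_partial \<Omega> i f g \<longleftrightarrow> f \<in> L1_loc \<Omega> \<and> g \<in> L1_loc \<Omega> \<and>
     (\<forall>\<phi>\<in>test_functions \<Omega>.
        (\<integral>x. f x * frechet_derivative \<phi> (at x) i \<partial>lebesgue_on \<Omega>) =
        - (\<integral>x. g x * \<phi> x \<partial>lebesgue_on \<Omega>))"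

text \<open>
  Weak partial derivatives are unique only up to null sets, so the following selects one
  representative; it is meaningful only if a weak partial derivative exists.
\<close>

definition weak_partial ::
    "'a::euclidean_space set \<Rightarrow> 'a \<Rightarrow> ('a \<Rightarrow> real) \<Rightarrow> 'a \<Rightarrow> real" where
  "weak_partial \<Omega> i f = (SOME g. has_weak_partial \<Omega> i f g)"

definition weak_grad ::
    "'a::euclidean_space set \<Rightarrow> ('a \<Rightarrow> real) \<Rightarrow> 'a \<Rightarrow> 'a" where
  "weak_grad \<Omega> u x = (\<Sum>i\<in>Basis. weak_partial \<Omega> i u x *\<^sub>R i)"

definition weak_div ::
    "'a::euclidean_space set \<Rightarrow> ('a \<Rightarrow> 'a) \<Rightarrow> 'a \<Rightarrow> real" where
  "weak_div \<Omega> G x = (\<Sum>i\<in>Basis. weak_partial \<Omega> i (\<lambda>y. G y \<bullet> i) x)"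

definition W1 :: "real \<Rightarrow> 'a::euclidean_space set \<Rightarrow> ('a \<Rightarrow> real) set" where
  "W1 p \<Omega> = {u. u \<in> Lp p \<Omega> \<and> (\<forall>i\<in>Basis. \<exists>g\<in>Lp p \<Omega>. has_weak_partial \<Omega> i u g)}"

definition W1_norm :: "real \<Rightarrow> 'a::euclidean_space set \<Rightarrow> ('a \<Rightarrow> real) \<Rightarrow> real" where
  "W1_norm p \<Omega> u =
     ((\<integral>x. \<bar>u x\<bar> powr p \<partial>lebesgue_on \<Omega>) +
      (\<Sum>i\<in>Basis. \<integral>x. \<bar>weak_partial \<Omega> i u x\<bar> powr p \<partial>lebesgue_on \<Omega>)) powr (1 / p)"

text \<open>The closure of \<open>C\<^sub>c\<^sup>\<infinity>(\<Omega>)\<close> in \<open>W\<^sup>1\<^sup>,\<^sup>p(\<Omega>)\<close>.\<close>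

definition W1_0 :: "real \<Rightarrow> 'a::euclidean_space set \<Rightarrow> ('a \<Rightarrow> real) set" where
  "W1_0 p \<Omega> = {u\<in>W1 p \<Omega>. \<forall>\<epsilon>>0. \<exists>\<phi>\<in>test_functions \<Omega>. W1_norm p \<Omega> (\<lambda>x. u x - \<phi> x) < \<epsilon>}"

definition W1_vec :: "real \<Rightarrow> 'a::euclidean_space set \<Rightarrow> ('a \<Rightarrow> 'a) set" where
  "W1_vec p \<Omega> = {G. \<forall>i\<in>Basis. (\<lambda>x. G x \<bullet> i) \<in> W1 p \<Omega>}"

definition functional ::
    "'a::euclidean_space set \<Rightarrow> ('a \<Rightarrow> 'a) \<Rightarrow> ('a \<Rightarrow> real) \<Rightarrow> ('a \<Rightarrow> real) \<Rightarrow> real" where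
  "functional \<Omega> F H u = (\<integral>x. norm (weak_grad \<Omega> u x + F x) + H x * u x \<partial>lebesgue_on \<Omega>)"

definition minimizer ::
    "'a::euclidean_space set \<Rightarrow> ('a \<Rightarrow> 'a) \<Rightarrow> ('a \<Rightarrow> real) \<Rightarrow> ('a \<Rightarrow> real) \<Rightarrow> bool" where
  "minimizer \<Omega> F H u \<longleftrightarrow> u \<in> W1 1 \<Omega> \<and>
     (\<forall>\<phi>\<in>W1_0 1 \<Omega>. functional \<Omega> F H u \<le> functional \<Omega> F H (\<lambda>x. u x + \<phi> x))"

text \<open>
  The coordinates of \<open>\<real>\<^sup>2\<^sup>n\<close> are indexed by \<open>'n \<times> bool\<close> with \<open>n = CARD('n)\<close>: for \<open>k\<close> ranging over
  \<open>1, \<dots>, n\<close>, the index \<open>(k, False)\<close> stands for \<open>2k - 1\<close> and \<open>(k, True)\<close> for \<open>2k\<close>. Thus \<open>star\<close>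
  sends \<open>(g\<^sub>1, g\<^sub>2, \<dots>)\<close> to \<open>(g\<^sub>2, -g\<^sub>1, \<dots>)\<close>.
\<close>

definition star :: "real ^ ('n::finite \<times> bool) \<Rightarrow> real ^ ('n \<times> bool)" where
  "star g = (\<chi> j. if snd j then - g $ (fst j, False) else g $ (fst j, True))"

end

theory Submission
  imports Defs
begin

text \<open>
  Write \<open>a = \<nabla>u + F\<close>, \<open>b = \<nabla>v + F\<close> and \<open>w = u - v\<close>. The functional is convex, so it is constant on
  the segment joining the two minimizers, which forces \<open>\<bar>a + b\<bar> = \<bar>a\<bar> + \<bar>b\<bar>\<close> almost everywhere. Then
  \<open>a\<close> and \<open>b\<close> are parallel, and since \<open>b\<close> is orthogonal to \<open>star b\<close>, so is \<open>\<nabla>w = a - b\<close>. Let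
  \<open>g t = t\<^sup>2 / (1 + t\<^sup>2)\<close>, which is nonnegative, bounded and Lipschitz. Testing \<open>star b\<close>, whose
  divergence is that of \<open>star F\<close>, against \<open>g \<circ> \<phi>\<close> for test functions \<open>\<phi>\<close> that converge to \<open>w\<close> in
  \<open>W\<^sup>1\<^sup>,\<^sup>2\<close> gives \<open>\<integral> g(w) div (star F) = - \<integral> g'(w) \<nabla>w \<bullet> star b = 0\<close>, hence \<open>g(w) = 0\<close>. The simpler
  choice \<open>g t = t\<^sup>2\<close> does not allow passing to the limit, as \<open>star b\<close> is only square integrable.
\<close>

subsection \<open>Functions of class \<open>C\<^sup>k\<close>\<close>

text \<open>The chain rule is applied only to smooth \<open>\<phi>\<close>, where it is classical.
  Orthogonality to \<open>star b\<close> is known for \<open>\<nabla>w\<close> alone, so for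
  \<open>\<phi>\<close> there remains an error, g'(\<phi>) (\<nabla>w - \<nabla>\<phi>) paired with
  \<open>star b\<close>; a bound on g' makes it small by Cauchy-Schwarz. With g t = t^2 the factor
  g'(\<phi>) = 2 \<phi> would turn the error into a product of three functions, each controlled only
  in L^2. Strict positivity of the divergence asks moreover that g be nonnegative with its only zero
  at 0.

  Two mismatches shape the rest. Minimality is tested against \<open>W1_0 1\<close>, whereas
  \<open>w\<close> lies in \<open>W1_0 2\<close>; boundedness of \<open>\<Omega>\<close> bridges the
  two. And \<open>weak_partial\<close> is an arbitrary choice of representative, so that even
  linearity of the gradient holds only almost everywhere and rests on uniqueness of weak
  derivatives. Uniqueness is the fundamental lemma of the calculus of variations, and it requires a
  supply of test functions, built here from exp (-1/t).\<close>

abbreviation pd :: "'a::euclidean_space \<Rightarrow> ('a \<Rightarrow> real) \<Rightarrow> 'a \<Rightarrow> real" where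
  "pd i f \<equiv> \<lambda>x. frechet_derivative f (at x) i"

lemma pd_eqI: "(f has_derivative f') (at x) \<Longrightarrow> frechet_derivative f (at x) i = f' i"
  using frechet_derivative_at by metis

lemma Ck_continuous: "Ck k f \<Longrightarrow> continuous_on UNIV f"
  by (cases k) (auto intro!: continuous_at_imp_continuous_on differentiable_imp_continuous_within)

lemma Ck_Suc_differentiable:
  "Ck (Suc k) f \<Longrightarrow> (f has_derivative frechet_derivative f (at x)) (at x)"
  using frechet_derivative_works by auto

lemma Ck_pd: "Ck (Suc k) f \<Longrightarrow> i \<in> Basis \<Longrightarrow> Ck k (pd i f)"
  by simp

lemma Ck_SucD: "Ck (Suc k) f \<Longrightarrow> Ck k f"
proof (induction k arbitrary: f)
  case 0
  then show ?case using Ck_continuous[OF 0] by simp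
next
  case (Suc k)
  then show ?case by (metis Ck.simps(2))
qed

text \<open>Allows the derivative to be any expression delivered by the derivative rules instead of
  the selected \<open>frechet_derivative\<close>.\<close>

lemma Ck_SucI:
  assumes "\<And>x. (f has_derivative f' x) (at x)" and "\<And>i. i \<in> Basis \<Longrightarrow> Ck k (\<lambda>x. f' x i)"
  shows "Ck (Suc k) f"
proof -
  have "frechet_derivative f (at x) = f' x" for x
    using frechet_derivative_at[OF assms(1)] by simp
  then show ?thesis
    using assms by (auto simp: differentiable_def)
qed

lemma Ck_const: "Ck k (\<lambda>x. c)"
  by (induction k arbitrary: c) auto

lemma Ck_add: "Ck k f \<Longrightarrow> Ck k g \<Longrightarrow> Ck k (\<lambda>x. f x + g x)"
proof (induction k arbitrary: f g)
  case 0
  then show ?case by (auto intro: continuous_intros)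
next
  case (Suc k)
  show ?case
    by (rule Ck_SucI, rule has_derivative_add[OF Ck_Suc_differentiable[OF Suc.prems(1)]
          Ck_Suc_differentiable[OF Suc.prems(2)]])
       (use Suc in auto)
qed

text \<open>The derivative of a product contains both factors undifferentiated, so the induction
  step needs them in class \<open>k\<close> as well; this is what \<open>Ck_SucD\<close>
  provides.\<close>

lemma Ck_mult: "Ck k f \<Longrightarrow> Ck k g \<Longrightarrow> Ck k (\<lambda>x. f x * g x)"
proof (induction k arbitrary: f g)
  case 0
  then show ?case by (auto intro: continuous_intros)
next
  case (Suc k)
  show ?case
    by (rule Ck_SucI, rule has_derivative_mult[OF Ck_Suc_differentiable[OF Suc.prems(1)]
          Ck_Suc_differentiable[OF Suc.prems(2)]])
       (use Suc Ck_SucD[OF Suc.prems(1)] Ck_SucD[OF Suc.prems(2)] in \<open>auto intro!: Ck_add\<close>)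
qed

lemma Ck_inverse:
  "Ck k f \<Longrightarrow> (\<And>x. f x \<noteq> 0) \<Longrightarrow> Ck k (\<lambda>x. inverse (f x))"
proof (induction k arbitrary: f)
  case 0
  then show ?case by (auto intro: continuous_intros)
next
  case (Suc k)
  have "Ck k (\<lambda>x. - 1 * (inverse (f x) * frechet_derivative f (at x) i * inverse (f x)))"
    if "i \<in> Basis" for i
    using Suc that Ck_SucD[OF Suc.prems(1)] by (intro Ck_mult Ck_const) auto
  then show ?case
    by (intro Ck_SucI[OF Deriv.has_derivative_inverse[OF _ Ck_Suc_differentiable[OF Suc.prems(1)]]])
       (use Suc in auto)
qed

lemma Ck_prod: "(\<And>j. j \<in> J \<Longrightarrow> Ck k (f j)) \<Longrightarrow> Ck k (\<lambda>x. \<Prod>j\<in>J. f j x)"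
  by (induction J rule: infinite_finite_induct) (auto intro: Ck_const Ck_mult)

text \<open>The functions \<open>t \<mapsto> t\<^sup>-\<^sup>m exp (-1/t)\<close> on \<open>t > 0\<close>, extended by zero: a family that contains the
  derivatives of its members up to linear combination, so all of them are smooth.\<close>

definition flat :: "nat \<Rightarrow> real \<Rightarrow> real" where
  "flat m t = (if t > 0 then inverse t ^ m * exp (- inverse t) else 0)"

text \<open>From the right, s = 1/t turns the limit into that of s^m / exp s at infinity; from the
  left the function is constantly zero.\<close>

lemma flat_tendsto_0: "(flat m \<longlongrightarrow> 0) (at 0)"
proof -
  have "((\<lambda>t. inverse t ^ m * exp (- inverse t)) \<longlongrightarrow> 0) (at_right (0::real))"
  proof -
    have "((\<lambda>s. s ^ m / exp s) \<longlongrightarrow> 0) (at_top :: real filter)"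
      by (rule tendsto_power_div_exp_0)
    from filterlim_compose[OF this filterlim_inverse_at_top_right]
    show ?thesis by (simp add: exp_minus divide_inverse)
  qed
  then have "(flat m \<longlongrightarrow> 0) (at_right 0)"
    by (rule Lim_transform_eventually)
       (auto simp: flat_def eventually_at_filter)
  moreover have "(flat m \<longlongrightarrow> 0) (at_left 0)"
    by (rule Lim_transform_eventually[of "\<lambda>_. 0"])
       (auto simp: flat_def eventually_at_filter)
  ultimately show ?thesis
    using filterlim_split_at_real by blast
qed

lemma flat_has_derivative:
  "(flat m has_real_derivative flat (m + 2) t - real m * flat (m + 1) t) (at t)"
proof -
  consider "t > 0" | "t < 0" | "t = 0" by linarith
  then show ?thesis
  proof cases
    case 1
    have "((\<lambda>t. inverse t ^ m * exp (- inverse t)) has_real_derivative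
        flat (m + 2) t - real m * flat (m + 1) t) (at t)"
    proof (cases m)
      case (Suc k)
      have inv: "(inverse has_real_derivative - (inverse t * inverse t)) (at t)"
        using 1 by (auto intro!: derivative_eq_intros)
      have "((\<lambda>t. exp (- inverse t)) has_real_derivative exp (- inverse t) * (inverse t * inverse t)) (at t)"
        using 1 by (auto intro!: derivative_eq_intros)
      from DERIV_mult[OF DERIV_power_Suc[OF inv, of k] this] 1 Suc show ?thesis
        by (simp add: flat_def algebra_simps)
    qed (use 1 in \<open>auto intro!: derivative_eq_intros simp: flat_def field_simps\<close>)
    then show ?thesis
      by (rule has_field_derivative_transform_within_open[where S = "{0<..}"])
         (use 1 in \<open>auto simp: flat_def\<close>)
  next
    case 2
    have "((\<lambda>t. 0) has_real_derivative flat (m + 2) t - real m * flat (m + 1) t) (at t)"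
      using 2 by (simp add: flat_def)
    then show ?thesis
      by (rule has_field_derivative_transform_within_open[where S = "{..<0}"])
         (use 2 in \<open>auto simp: flat_def\<close>)
  next
    case 3
    \<comment> \<open>The difference quotient of \<open>flat m\<close> at 0 is
      \<open>flat (m + 1)\<close>, because dividing by h raises the power of 1/h by one.\<close>
    have "((\<lambda>h. (flat m h - flat m 0) / (h - 0)) \<longlongrightarrow> 0) (at 0)"
      by (rule Lim_transform_eventually[OF flat_tendsto_0[of "m + 1"]])
         (auto simp: flat_def eventually_at_filter field_simps)
    then show ?thesis
      using 3 by (simp add: has_field_derivative_iff flat_def)
  qed
qed

text \<open>The induction keeps \<open>m\<close> arbitrary, since differentiation leads to
  \<open>flat (m + 1)\<close> and \<open>flat (m + 2)\<close>. The affine argument covers the faces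
  of a box, and its derivative does not depend on the point.\<close>

lemma Ck_flat: "Ck k (\<lambda>x. flat m (c * (x \<bullet> i) + d))"
proof (induction k arbitrary: m)
  case 0
  have "isCont (flat m) t" for t
    using DERIV_isCont flat_has_derivative by blast
  then have "continuous_on UNIV (flat m)"
    by (simp add: continuous_at_imp_continuous_on)
  then have "continuous_on UNIV (\<lambda>x. flat m (c * (x \<bullet> i) + d))"
    by (rule continuous_on_compose2) (auto intro!: continuous_intros)
  then show ?case by simp
next
  case (Suc k)
  let ?p = "\<lambda>x. c * (x \<bullet> i) + d"
  have *: "((\<lambda>x. flat m (?p x)) has_derivative
      (\<lambda>h. (c * (h \<bullet> i)) * (flat (m + 2) (?p x) + (- real m) * flat (m + 1) (?p x)))) (at x)" for x
  proof -
    have "(?p has_derivative (\<lambda>h. c * (h \<bullet> i))) (at x)"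
      by (auto intro!: derivative_eq_intros)
    from has_derivative_compose[OF this flat_has_derivative[of m, THEN has_field_derivative_imp_has_derivative]]
    show ?thesis by (simp add: mult.commute)
  qed
  show ?case
    by (rule Ck_SucI[OF *]) (intro Ck_mult Ck_add Ck_const Suc.IH)
qed

lemma flat_0_le_1: "0 \<le> flat 0 t" "flat 0 t \<le> 1"
  by (auto simp: flat_def)

text \<open>For t > 0 the value is exp (-1/(n t)), so scaling sharpens the smooth ramp
  \<open>flat 0\<close> into the indicator of the open half line.\<close>

lemma flat_0_scaled_tendsto: "(\<lambda>n. flat 0 (real n * t)) \<longlonglongrightarrow> (if t > 0 then 1 else 0)"
proof (cases "t > 0")
  case True
  have "(\<lambda>n. exp (- (inverse (real n) * inverse t))) \<longlonglongrightarrow> exp (- (0 * inverse t))"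
    by (intro tendsto_intros lim_inverse_n)
  then have "(\<lambda>n. exp (- (inverse (real n) * inverse t))) \<longlonglongrightarrow> 1" by simp
  then have "(\<lambda>n. flat 0 (real n * t)) \<longlonglongrightarrow> 1"
    by (rule Lim_transform_eventually)
       (use True in \<open>auto simp: flat_def eventually_sequentially intro!: exI[of _ 1]\<close>)
  then show ?thesis using True by simp
next
  case False
  then show ?thesis
    by (auto simp: flat_def zero_less_mult_iff)
qed

subsection \<open>Test functions\<close>

lemma test_functionsI:
  assumes "\<And>k. Ck k f" and "compact K" and "K \<subseteq> \<Omega>" and "\<And>x. x \<notin> K \<Longrightarrow> f x = 0"
  shows "f \<in> test_functions \<Omega>"
proof -
  have "closure {x. f x \<noteq> 0} \<subseteq> K"
    using assms by (intro closure_minimal compact_imp_closed) auto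
  moreover have "compact (closure {x. f x \<noteq> 0})"
    using \<open>compact K\<close> calculation by (metis closed_closure compact_Int_closed inf.absorb2)
  ultimately show ?thesis
    using assms unfolding test_functions_def by auto
qed

text \<open>\<open>K\<close> is the support itself. Its complement is open, so that a function
  vanishing there has vanishing derivatives there too.\<close>

lemma test_functionsE:
  assumes "\<phi> \<in> test_functions \<Omega>"
  obtains K where "compact K" and "K \<subseteq> \<Omega>" and "\<And>x. x \<notin> K \<Longrightarrow> \<phi> x = 0"
    and "\<And>x i. x \<notin> K \<Longrightarrow> frechet_derivative \<phi> (at x) i = 0"
proof -
  let ?K = "closure {x. \<phi> x \<noteq> 0}"
  have 0: "\<phi> x = 0" if "x \<notin> ?K" for x
    using that closure_subset[of "{x. \<phi> x \<noteq> 0}"] by blast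
  have "frechet_derivative \<phi> (at x) i = 0" if "x \<notin> ?K" for x i
  proof -
    have "(\<phi> has_derivative (\<lambda>_. 0)) (at x)"
    proof (rule has_derivative_transform_within_open[OF has_derivative_const])
      show "open (- ?K)" by (rule open_Compl[OF closed_closure])
      show "x \<in> - ?K" using that by blast
      show "0 = \<phi> y" if "y \<in> - ?K" for y
        using 0[of y] ComplD[OF that] by simp
    qed
    then show ?thesis by (simp add: pd_eqI)
  qed
  moreover have "compact ?K" "?K \<subseteq> \<Omega>"
    using assms unfolding test_functions_def by blast+
  ultimately show thesis
    using 0 that by metis
qed

lemma test_functions_Ck: "\<phi> \<in> test_functions \<Omega> \<Longrightarrow> Ck k \<phi>"
  by (auto simp: test_functions_def)

lemma test_functions_has_derivative:
  "\<phi> \<in> test_functions \<Omega> \<Longrightarrow> (\<phi> has_derivative frechet_derivative \<phi> (at x)) (at x)"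
  by (rule Ck_Suc_differentiable[OF test_functions_Ck])

lemma test_functions_mult:
  assumes "\<phi> \<in> test_functions \<Omega>" and "\<And>k. Ck k f"
  shows "(\<lambda>x. f x * \<phi> x) \<in> test_functions \<Omega>"
  using assms(1)
  by (rule test_functionsE)
     (rule test_functionsI, auto intro!: Ck_mult assms test_functions_Ck[OF assms(1)])

lemma test_functions_cmult: "\<phi> \<in> test_functions \<Omega> \<Longrightarrow> (\<lambda>x. c * \<phi> x) \<in> test_functions \<Omega>"
  by (intro test_functions_mult Ck_const)

lemma test_functions_pd:
  assumes "\<phi> \<in> test_functions \<Omega>" and "i \<in> Basis"
  shows "pd i \<phi> \<in> test_functions \<Omega>"
  using assms(1)
  by (rule test_functionsE)
     (rule test_functionsI[OF Ck_pd[OF test_functions_Ck[OF assms(1)] assms(2)]], auto)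

text \<open>Each coordinate contributes one ramp for each of the two faces of the box orthogonal to
  it. As \<open>n\<close> grows, the product tends to the indicator of the open box and stays
  between 0 and 1.\<close>

definition box_bump :: "'a::euclidean_space \<Rightarrow> 'a \<Rightarrow> nat \<Rightarrow> 'a \<Rightarrow> real" where
  "box_bump a b n x =
     (\<Prod>i\<in>Basis. flat 0 (real n * (x \<bullet> i - a \<bullet> i)) * flat 0 (real n * (b \<bullet> i - x \<bullet> i)))"

lemma Ck_box_bump: "Ck k (box_bump a b n)"
proof -
  have "Ck k (\<lambda>x. \<Prod>i\<in>Basis. flat 0 (real n * (x \<bullet> i) + - real n * (a \<bullet> i)) *
      flat 0 (- real n * (x \<bullet> i) + real n * (b \<bullet> i)))"
    by (intro Ck_prod Ck_mult Ck_flat)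
  also have "(\<lambda>x. \<Prod>i\<in>Basis. flat 0 (real n * (x \<bullet> i) + - real n * (a \<bullet> i)) *
      flat 0 (- real n * (x \<bullet> i) + real n * (b \<bullet> i))) = box_bump a b n"
    by (simp add: box_bump_def fun_eq_iff algebra_simps)
  finally show ?thesis .
qed

lemma box_bump_eq_0: "x \<notin> box a b \<Longrightarrow> box_bump a b n x = 0"
proof -
  assume "x \<notin> box a b"
  then obtain i where "i \<in> Basis" "\<not> (a \<bullet> i < x \<bullet> i \<and> x \<bullet> i < b \<bullet> i)"
    by (auto simp: box_def)
  then show ?thesis
    unfolding box_bump_def
    by (intro prod_zero) (auto intro!: bexI[of _ i] simp: flat_def zero_less_mult_iff)
qed

lemma box_bump_bounds: "0 \<le> box_bump a b n x" "box_bump a b n x \<le> 1"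
  unfolding box_bump_def
  by (auto intro!: prod_nonneg prod_le_1 mult_nonneg_nonneg mult_le_one flat_0_le_1)

lemma box_bump_tendsto: "(\<lambda>n. box_bump a b n x) \<longlonglongrightarrow> indicator (box a b) x"
proof (cases "x \<in> box a b")
  case False
  then show ?thesis by (simp add: box_bump_eq_0)
next
  case True
  have "(\<lambda>n. box_bump a b n x) \<longlonglongrightarrow> (\<Prod>i\<in>(Basis :: 'a set). 1 * 1)"
    unfolding box_bump_def
  proof (intro tendsto_prod tendsto_mult)
    fix i :: 'a assume i: "i \<in> Basis"
    show "(\<lambda>n. flat 0 (real n * (x \<bullet> i - a \<bullet> i))) \<longlonglongrightarrow> 1"
      using flat_0_scaled_tendsto[of "x \<bullet> i - a \<bullet> i"] True i by (auto simp: box_def)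
    show "(\<lambda>n. flat 0 (real n * (b \<bullet> i - x \<bullet> i))) \<longlonglongrightarrow> 1"
      using flat_0_scaled_tendsto[of "b \<bullet> i - x \<bullet> i"] True i by (auto simp: box_def)
  qed
  with True show ?thesis by simp
qed

lemma box_bump_test_function: "cbox a b \<subseteq> \<Omega> \<Longrightarrow> box_bump a b n \<in> test_functions \<Omega>"
  by (rule test_functionsI[where K = "cbox a b", OF Ck_box_bump])
     (auto intro!: box_bump_eq_0 dest: subsetD[OF box_subset_cbox])

subsection \<open>Classical derivatives along a coordinate direction\<close>

lemma Ck_slice_DERIV:
  assumes "Ck (Suc k) f"
  shows "((\<lambda>t. f (x + t *\<^sub>R i)) has_real_derivative frechet_derivative f (at (x + t *\<^sub>R i)) i) (at t)"
proof -
  let ?D = "frechet_derivative f (at (x + t *\<^sub>R i))"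
  have f: "(f has_derivative ?D) (at (x + t *\<^sub>R i))"
    using Ck_Suc_differentiable[OF assms] .
  have "((\<lambda>t. x + t *\<^sub>R i) has_derivative (\<lambda>h. h *\<^sub>R i)) (at t)"
    by (auto intro!: derivative_eq_intros)
  from has_derivative_compose[OF this f]
  have "((\<lambda>t. f (x + t *\<^sub>R i)) has_derivative (\<lambda>h. ?D (h *\<^sub>R i))) (at t)" .
  moreover have "(\<lambda>h. ?D (h *\<^sub>R i)) = (\<lambda>h. ?D i * h)"
    using linear_cmul[OF has_derivative_linear[OF f]] by (auto simp: mult.commute)
  ultimately show ?thesis
    by (simp add: has_field_derivative_def)
qed

lemma Ck_slice_MVT:
  assumes "Ck (Suc k) f" and "0 < h"
  shows "\<exists>t. 0 < t \<and> t < h \<and> f (x + h *\<^sub>R i) - f x = h * frechet_derivative f (at (x + t *\<^sub>R i)) i"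
  using MVT2[of 0 h "\<lambda>t. f (x + t *\<^sub>R i)" "\<lambda>t. frechet_derivative f (at (x + t *\<^sub>R i)) i"]
    assms(2) Ck_slice_DERIV[OF assms(1)] by auto

text \<open>The mean value theorem is used twice: along \<open>i\<close> for the increment of
  \<open>f\<close> in direction \<open>j\<close>, then along \<open>j\<close> for
  \<open>pd i f\<close>. Exchanging \<open>i\<close> and \<open>j\<close> changes the right side but
  not the left.\<close>

lemma second_difference_eq:
  assumes "Ck (Suc (Suc k)) f" and "i \<in> Basis" and "j \<in> Basis" and "0 < h"
  shows "\<exists>y. dist y x \<le> 2 * h \<and>
    f (x + h *\<^sub>R i + h *\<^sub>R j) - f (x + h *\<^sub>R i) - f (x + h *\<^sub>R j) + f x = h * (h * pd j (pd i f) y)"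
proof -
  let ?\<phi> = "\<lambda>t. f (x + h *\<^sub>R j + t *\<^sub>R i) - f (x + t *\<^sub>R i)"
  let ?\<phi>' = "\<lambda>t. pd i f (x + h *\<^sub>R j + t *\<^sub>R i) - pd i f (x + t *\<^sub>R i)"
  have "\<exists>s. 0 < s \<and> s < h \<and> ?\<phi> h - ?\<phi> 0 = (h - 0) * ?\<phi>' s"
    by (rule MVT2[OF \<open>0 < h\<close>]) (intro DERIV_diff Ck_slice_DERIV[OF assms(1)])
  then obtain s where s: "0 < s" "s < h" "?\<phi> h - ?\<phi> 0 = h * ?\<phi>' s" by auto
  obtain t where t: "0 < t" "t < h"
    "pd i f (x + s *\<^sub>R i + h *\<^sub>R j) - pd i f (x + s *\<^sub>R i) = h * pd j (pd i f) (x + s *\<^sub>R i + t *\<^sub>R j)"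
    using Ck_slice_MVT[OF Ck_pd[OF assms(1,2)] assms(4)] by blast
  have "dist (x + s *\<^sub>R i + t *\<^sub>R j) x \<le> norm (s *\<^sub>R i) + norm (t *\<^sub>R j)"
    by (simp add: dist_norm add.assoc norm_triangle_ineq del: norm_scaleR)
  also have "\<dots> \<le> 2 * h"
    using s t assms by simp
  finally show ?thesis
    using s(3) t(3) by (intro exI[of _ "x + s *\<^sub>R i + t *\<^sub>R j"]) (simp add: algebra_simps)
qed

text \<open>The two evaluations of the symmetric second difference give equal mixed derivatives at
  two nearby points; both points tend to \<open>x\<close> as the step shrinks, and the mixed
  derivatives are continuous.\<close>

lemma pd_commute:
  assumes "Ck (Suc (Suc k)) f" and "i \<in> Basis" and "j \<in> Basis"
  shows "pd i (pd j f) x = pd j (pd i f) x"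
proof -
  let ?h = "\<lambda>n. inverse (real (Suc n))"
  have "\<exists>y z. dist y x \<le> 2 * ?h n \<and> dist z x \<le> 2 * ?h n \<and> pd j (pd i f) y = pd i (pd j f) z" for n
  proof -
    have h: "0 < ?h n" by simp
    obtain y where y: "dist y x \<le> 2 * ?h n"
      "f (x + ?h n *\<^sub>R i + ?h n *\<^sub>R j) - f (x + ?h n *\<^sub>R i) - f (x + ?h n *\<^sub>R j) + f x
        = ?h n * (?h n * pd j (pd i f) y)"
      using second_difference_eq[OF assms h] by blast
    obtain z where z: "dist z x \<le> 2 * ?h n"
      "f (x + ?h n *\<^sub>R j + ?h n *\<^sub>R i) - f (x + ?h n *\<^sub>R j) - f (x + ?h n *\<^sub>R i) + f x
        = ?h n * (?h n * pd i (pd j f) z)"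
      using second_difference_eq[OF assms(1,3,2) h] by blast
    have "?h n * (?h n * pd j (pd i f) y) = ?h n * (?h n * pd i (pd j f) z)"
      using y(2) z(2) by (simp only: add.assoc add.commute[of "?h n *\<^sub>R i"])
    with y(1) z(1) h show ?thesis
      by (metis mult_cancel_left less_irrefl)
  qed
  then obtain y z where yz: "\<And>n. dist (y n) x \<le> 2 * ?h n" "\<And>n. dist (z n) x \<le> 2 * ?h n"
    "\<And>n. pd j (pd i f) (y n) = pd i (pd j f) (z n)"
    by metis
  have h0: "(\<lambda>n. 2 * ?h n) \<longlonglongrightarrow> 0"
    using tendsto_mult[OF tendsto_const[of "2::real"] LIMSEQ_inverse_real_of_nat] by simp
  have lim: "y \<longlonglongrightarrow> x" "z \<longlonglongrightarrow> x"
    using yz(1,2) by (auto intro!: metric_tendsto_imp_tendsto[OF h0])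
  have cont: "isCont (pd i (pd j f)) x" "isCont (pd j (pd i f)) x"
    using Ck_continuous[OF Ck_pd[OF Ck_pd[OF assms(1,3)] assms(2)]]
      Ck_continuous[OF Ck_pd[OF Ck_pd[OF assms(1,2)] assms(3)]]
    by (simp_all add: continuous_on_eq_continuous_at)
  have "(\<lambda>n. pd i (pd j f) (z n)) \<longlonglongrightarrow> pd i (pd j f) x"
    using isCont_tendsto_compose[OF cont(1) lim(2)] .
  moreover have "(\<lambda>n. pd i (pd j f) (z n)) \<longlonglongrightarrow> pd j (pd i f) x"
    using isCont_tendsto_compose[OF cont(2) lim(1)] yz(3) by simp
  ultimately show ?thesis
    by (rule LIMSEQ_unique)
qed

subsection \<open>Integration by parts\<close>

lemma integrable_compact_support:
  fixes f :: "'a::euclidean_space \<Rightarrow> real"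
  assumes "continuous_on UNIV f" and "compact K" and "\<And>x. x \<notin> K \<Longrightarrow> f x = 0"
  shows "integrable lborel f"
proof -
  have "integrable lborel (\<lambda>x. indicator K x *\<^sub>R f x)"
    using assms by (intro borel_integrable_compact continuous_on_subset[OF assms(1)]) auto
  also have "(\<lambda>x. indicator K x *\<^sub>R f x) = f"
    using assms(3) by (auto simp: indicator_def fun_eq_iff)
  finally show ?thesis .
qed

lemma bounded_compact_support:
  fixes f :: "'a::euclidean_space \<Rightarrow> real"
  assumes "continuous_on UNIV f" and "compact K" and "\<And>x. x \<notin> K \<Longrightarrow> f x = 0"
  obtains C where "C \<ge> 0" and "\<And>x. \<bar>f x\<bar> \<le> C"
proof -
  have "bounded (f ` K)"
    by (meson assms(1,2) compact_continuous_image compact_imp_bounded continuous_on_subset subset_UNIV)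
  then obtain C where C: "\<And>x. x \<in> K \<Longrightarrow> \<bar>f x\<bar> \<le> C"
    unfolding bounded_iff by auto
  have "\<bar>f x\<bar> \<le> \<bar>C\<bar>" for x
    using C[of x] assms(3)[of x] by (cases "x \<in> K") auto
  then show thesis
    by (intro that[of "\<bar>C\<bar>"]) auto
qed

lemma lborel_integral_translate:
  fixes f :: "'a::euclidean_space \<Rightarrow> real"
  assumes "f \<in> borel_measurable borel"
  shows "(\<integral>x. f (x + c) \<partial>lborel) = (\<integral>x. f x \<partial>lborel)"
proof -
  have "(\<integral>x. f x \<partial>lborel) = (\<integral>x. f x \<partial>distr lborel borel ((+) c))"
    by (simp add: lborel_distr_plus)
  also have "\<dots> = (\<integral>x. f (c + x) \<partial>lborel)"
    by (rule integral_distr) (use assms in auto)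
  finally show ?thesis by (simp add: add.commute)
qed

text \<open>Translation invariance makes the integrals of all difference quotients vanish.\<close>

lemma integral_pd_eq_0:
  assumes "Ck (Suc k) f" and "i \<in> Basis" and "compact K"
    and 0: "\<And>x. x \<notin> K \<Longrightarrow> f x = 0" and D0: "\<And>x. x \<notin> K \<Longrightarrow> pd i f x = 0"
  shows "(\<integral>x. pd i f x \<partial>lborel) = 0"
proof -
  let ?h = "\<lambda>n. inverse (real (Suc n))"
  define s where "s n x = (f (x + ?h n *\<^sub>R i) - f x) / ?h n" for n x
  have cf: "continuous_on UNIV f" and cD: "continuous_on UNIV (pd i f)"
    using Ck_continuous[OF assms(1)] Ck_continuous[OF Ck_pd[OF assms(1,2)]] .
  have [measurable]: "f \<in> borel_measurable borel" "pd i f \<in> borel_measurable borel"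
    using cf cD by (auto intro: borel_measurable_continuous_onI)
  obtain C where C: "C \<ge> 0" "\<And>x. \<bar>pd i f x\<bar> \<le> C"
    using bounded_compact_support[OF cD \<open>compact K\<close> D0] by blast
  obtain R where R: "\<And>x. x \<in> K \<Longrightarrow> norm x \<le> R"
    using compact_imp_bounded[OF \<open>compact K\<close>] unfolding bounded_iff by auto
  have h: "0 < ?h n" "?h n \<le> 1" for n
    by (auto simp: field_simps)
  have intf: "integrable lborel f"
    using integrable_compact_support[OF cf \<open>compact K\<close> 0] .
  have intft: "integrable lborel (\<lambda>x. f (x + c))" for c
  proof (rule integrable_compact_support[where K = "(\<lambda>x. x - c) ` K"])
    show "continuous_on UNIV (\<lambda>x. f (x + c))"
      by (rule continuous_on_compose2[OF cf]) (auto intro!: continuous_intros)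
    show "compact ((\<lambda>x. x - c) ` K)"
      by (intro compact_continuous_image continuous_intros \<open>compact K\<close>)
    show "f (x + c) = 0" if "x \<notin> (\<lambda>x. x - c) ` K" for x
      using that by (intro 0) (metis add_diff_cancel_right' image_eqI)
  qed
  \<comment> \<open>The shifts have length at most 1, so all quotients vanish outside the ball of
    radius \<open>R + 1\<close>; inside it the mean value theorem bounds them by the bound
    \<open>C\<close> of the derivative.\<close>
  have "(\<lambda>n. \<integral>x. s n x \<partial>lborel) \<longlonglongrightarrow> (\<integral>x. pd i f x \<partial>lborel)"
  proof (rule integral_dominated_convergence[where w = "\<lambda>x. C * indicator (cball 0 (R + 1)) x"])
    show "s n \<in> borel_measurable lborel" for n
      unfolding s_def by measurable
    show "integrable lborel (\<lambda>x::'a. C * indicator (cball 0 (R + 1)) x)"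
      by (intro integrable_mult_right integrable_real_indicator) (auto intro: emeasure_lborel_cball_finite[unfolded infinity_ennreal_def])
    show "AE x in lborel. (\<lambda>n. s n x) \<longlonglongrightarrow> pd i f x"
    proof (rule AE_I2)
      fix x
      have "((\<lambda>t. (f (x + t *\<^sub>R i) - f x) / t) \<longlongrightarrow> pd i f x) (at 0)"
        using Ck_slice_DERIV[OF assms(1), of x i 0] by (simp add: has_field_derivative_iff)
      moreover have "filterlim ?h (at 0) sequentially"
        unfolding filterlim_at using LIMSEQ_inverse_real_of_nat by auto
      ultimately show "(\<lambda>n. s n x) \<longlonglongrightarrow> pd i f x"
        unfolding s_def by (rule filterlim_compose)
    qed
    show "AE x in lborel. norm (s n x) \<le> C * indicator (cball 0 (R + 1)) x" for n
    proof (rule AE_I2)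
      fix x
      show "norm (s n x) \<le> C * indicator (cball 0 (R + 1)) x"
      proof (cases "x \<in> cball 0 (R + 1)")
        case True
        obtain t where "f (x + ?h n *\<^sub>R i) - f x = ?h n * pd i f (x + t *\<^sub>R i)"
          using Ck_slice_MVT[OF assms(1) h(1)] by blast
        then have "s n x = pd i f (x + t *\<^sub>R i)"
          using h(1)[of n] by (simp add: s_def)
        with C True show ?thesis by simp
      next
        case False
        then have "norm x > R + 1" by simp
        moreover have "norm x \<le> norm (x + ?h n *\<^sub>R i) + ?h n"
          using norm_triangle_ineq4[of "x + ?h n *\<^sub>R i" "?h n *\<^sub>R i"] \<open>i \<in> Basis\<close> by simp
        ultimately have "x \<notin> K" "x + ?h n *\<^sub>R i \<notin> K"
          using R[of x] R[of "x + ?h n *\<^sub>R i"] h[of n] by linarith+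
        then have "s n x = 0" using 0 by (simp add: s_def)
        with False show ?thesis by simp
      qed
    qed
  qed auto
  moreover have "(\<integral>x. s n x \<partial>lborel) = 0" for n
    unfolding s_def using intf intft
    by (simp add: lborel_integral_translate del: of_nat_Suc)
  ultimately show ?thesis
    by (simp add: LIMSEQ_const_iff)
qed

text \<open>The product with \<open>\<phi>\<close> has compact support, whatever \<open>f\<close>
  does at infinity, so its derivative integrates to zero.\<close>

lemma integral_by_parts_test:
  assumes f: "Ck (Suc k) f" and \<phi>: "\<phi> \<in> test_functions \<Omega>" and i: "i \<in> Basis"
  shows "(\<integral>x. f x * pd i \<phi> x \<partial>lborel) = - (\<integral>x. pd i f x * \<phi> x \<partial>lborel)"
proof -
  obtain K where K: "compact K" "\<And>x. x \<notin> K \<Longrightarrow> \<phi> x = 0" "\<And>x i. x \<notin> K \<Longrightarrow> pd i \<phi> x = 0"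
    using test_functionsE[OF \<phi>] by metis
  have pd: "pd i (\<lambda>x. f x * \<phi> x) x = f x * pd i \<phi> x + pd i f x * \<phi> x" for x
    using pd_eqI[OF has_derivative_mult[OF Ck_Suc_differentiable[OF f]
          test_functions_has_derivative[OF \<phi>]]] .
  note cont = Ck_continuous[OF f] Ck_continuous[OF Ck_pd[OF f i]]
    Ck_continuous[OF test_functions_Ck[OF \<phi>]]
    Ck_continuous[OF test_functions_Ck[OF test_functions_pd[OF \<phi> i]]]
  have int: "integrable lborel (\<lambda>x. f x * pd i \<phi> x)" "integrable lborel (\<lambda>x. pd i f x * \<phi> x)"
    by (rule integrable_compact_support[OF _ K(1)], auto intro!: continuous_on_mult cont simp: K)+
  have "(\<integral>x. pd i (\<lambda>x. f x * \<phi> x) x \<partial>lborel) = 0"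
    by (rule integral_pd_eq_0[OF Ck_mult[OF f test_functions_Ck[OF \<phi>]] i K(1)])
       (use K pd in auto)
  with int show ?thesis
    unfolding pd by simp
qed

subsection \<open>The fundamental lemma of the calculus of variations\<close>

lemma integral_lebesgue_on_eq_lborel:
  fixes f :: "'a::euclidean_space \<Rightarrow> real"
  assumes "\<Omega> \<in> sets lebesgue" and "f \<in> borel_measurable borel" and "\<And>x. x \<notin> \<Omega> \<Longrightarrow> f x = 0"
  shows "(\<integral>x. f x \<partial>lebesgue_on \<Omega>) = (\<integral>x. f x \<partial>lborel)"
proof -
  have "(\<lambda>x. indicator \<Omega> x *\<^sub>R f x) = f"
    using assms(3) by (auto simp: indicator_def fun_eq_iff)
  then show ?thesis
    using assms by (simp add: integral_restrict_space integral_completion)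
qed

text \<open>The sets over which \<open>f\<close> integrates to zero form a Dynkin system, where the
  hypothesis on the whole space supplies complements. Open boxes are an intersection-stable
  generator of the Borel sets, so the integral vanishes over each Borel set.\<close>

lemma AE_lborel_eq_0_if_integral_box_eq_0:
  fixes f :: "'a::euclidean_space \<Rightarrow> real"
  assumes f: "integrable lborel f" and UNIV: "(\<integral>x. f x \<partial>lborel) = 0"
    and box: "\<And>a b. (LINT x:box a b|lborel. f x) = 0"
  shows "AE x in lborel. f x = 0"
proof (rule sigma_finite_measure.density_zero[OF sigma_finite_lborel f])
  fix A :: "'a set" assume "A \<in> sets lborel"
  let ?G = "range (\<lambda>(a, b). box a b :: 'a set)"
  have setint: "set_integrable lborel B f" if "B \<in> sets borel" for B
    unfolding set_integrable_def using f that by (intro integrable_mult_indicator) auto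
  have borel: "sigma_sets UNIV ?G = sets (borel :: 'a measure)"
    by (subst borel_eq_box) (simp add: sets_measure_of)
  have "A \<in> sigma_sets UNIV ?G"
    using \<open>A \<in> sets lborel\<close> by (simp add: borel)
  moreover have "Int_stable ?G"
  proof (rule Int_stableI)
    fix X Y assume "X \<in> ?G" "Y \<in> ?G"
    then obtain a b c d where "X = box a b" "Y = box c d" by auto
    moreover obtain p q where "box a b \<inter> box c d = box p q"
      using box_Int_box[of a b c d] by (rule that)
    ultimately have "X \<inter> Y = (\<lambda>(a, b). box a b) (p, q)" by simp
    then show "X \<inter> Y \<in> ?G" by (rule range_eqI)
  qed
  moreover have "?G \<subseteq> Pow UNIV" by simp
  ultimately have "Int_stable ?G" "?G \<subseteq> Pow UNIV" "A \<in> sigma_sets UNIV ?G" by auto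
  then show "(LINT x:A|lborel. f x) = 0"
  proof (induction rule: sigma_sets_induct_disjoint)
    case (basic A)
    then show ?case using box by auto
  next
    case empty
    show ?case by (simp add: set_lebesgue_integral_def)
  next
    case (compl A)
    then have "A \<in> sets lborel" by (simp add: borel)
    have "(LINT x:UNIV|lborel. f x) = (LINT x:(UNIV - A) \<union> A|lborel. f x)"
      by simp
    also have "\<dots> = (LINT x:UNIV - A|lborel. f x) + (LINT x:A|lborel. f x)"
      by (rule set_integral_Un) (use \<open>A \<in> sets lborel\<close> in \<open>auto intro!: setint\<close>)
    finally show ?case
      using UNIV compl(2) by (simp add: set_lebesgue_integral_def)
  next
    case (union A)
    then have A: "A i \<in> sets lborel" for i by (auto simp: borel)
    have "(LINT x:(\<Union>i. A i)|lborel. f x) = (\<Sum>i. (LINT x:A i|lborel. f x))"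
      by (rule lebesgue_integral_countable_add)
         (use A union(1) in \<open>auto intro!: setint simp: disjoint_family_on_def\<close>)
    then show ?case using union by simp
  qed
qed

text \<open>As \<open>g\<close> is only locally integrable, the argument runs on one box with
  closure in \<open>\<Omega>\<close> at a time, and countably many boxes are put together at the
  end.\<close>

lemma AE_eq_0_if_orthogonal_test_functions:
  assumes "open \<Omega>" and g: "g \<in> L1_loc \<Omega>"
    and orth: "\<And>\<phi>. \<phi> \<in> test_functions \<Omega> \<Longrightarrow> (\<integral>x. g x * \<phi> x \<partial>lebesgue_on \<Omega>) = 0"
  shows "AE x in lebesgue_on \<Omega>. g x = 0"
proof -
  have [simp]: "\<Omega> \<in> sets lebesgue" using \<open>open \<Omega>\<close> by simp
  have cbox_int: "integrable lebesgue (\<lambda>x. indicator (cbox a b) x * g x)"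
    if "cbox a b \<subseteq> \<Omega>" for a b
  proof -
    have "integrable (lebesgue_on (cbox a b)) g"
      using g that compact_cbox unfolding L1_loc_def by blast
    then show ?thesis
      by (simp add: integrable_restrict_space)
  qed
  have box_int: "integrable lebesgue (\<lambda>x. indicator (box a b) x * g x)"
    if "cbox a b \<subseteq> \<Omega>" for a b
  proof -
    have "integrable lebesgue (\<lambda>x. indicator (box a b) x *\<^sub>R (indicator (cbox a b) x * g x))"
      by (intro integrable_mult_indicator cbox_int that) auto
    also have "(\<lambda>x. indicator (box a b) x *\<^sub>R (indicator (cbox a b) x * g x)) =
        (\<lambda>x. indicator (box a b) x * g x)"
      using box_subset_cbox[of a b] by (auto simp: fun_eq_iff indicator_def)
    finally show ?thesis .
  qed
  \<comment> \<open>The bumps are test functions that tend to the indicator of the open box, and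
    \<open>g\<close> restricted to the closed box dominates the products.\<close>
  have box0: "(\<integral>x. indicator (box a b) x * g x \<partial>lebesgue) = 0" if "cbox a b \<subseteq> \<Omega>" for a b
  proof -
    have "(\<lambda>n. \<integral>x. box_bump a b n x * (indicator (cbox a b) x * g x) \<partial>lebesgue)
        \<longlonglongrightarrow> (\<integral>x. indicator (box a b) x * (indicator (cbox a b) x * g x) \<partial>lebesgue)"
    proof (rule integral_dominated_convergence[where w = "\<lambda>x. \<bar>indicator (cbox a b) x * g x\<bar>"])
      have m: "(\<lambda>x. indicator (cbox a b) x * g x) \<in> borel_measurable lebesgue"
        using cbox_int[OF that] by (rule borel_measurable_integrable)
      have "box_bump a b n \<in> borel_measurable lborel" for n
        using borel_measurable_continuous_onI[OF Ck_continuous[OF Ck_box_bump[of 0 a b n]]] by simp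
      from borel_measurable_times[OF measurable_completion[OF this] m]
      show "(\<lambda>x. box_bump a b n x * (indicator (cbox a b) x * g x)) \<in> borel_measurable lebesgue" for n .
      have "(indicator (box a b) :: 'a \<Rightarrow> real) \<in> borel_measurable lebesgue"
        by (intro borel_measurable_indicator) auto
      from borel_measurable_times[OF this m]
      show "(\<lambda>x. indicator (box a b) x * (indicator (cbox a b) x * g x)) \<in> borel_measurable lebesgue" .
      show "integrable lebesgue (\<lambda>x. \<bar>indicator (cbox a b) x * g x\<bar>)"
        using cbox_int[OF that] by simp
      show "AE x in lebesgue. (\<lambda>n. box_bump a b n x * (indicator (cbox a b) x * g x))
          \<longlonglongrightarrow> indicator (box a b) x * (indicator (cbox a b) x * g x)"
        by (intro AE_I2 tendsto_mult box_bump_tendsto tendsto_const)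
      show "AE x in lebesgue. norm (box_bump a b n x * (indicator (cbox a b) x * g x))
          \<le> \<bar>indicator (cbox a b) x * g x\<bar>" for n
      proof (rule AE_I2)
        fix x
        have "\<bar>box_bump a b n x\<bar> \<le> 1"
          using box_bump_bounds[of a b n x] by simp
        then show "norm (box_bump a b n x * (indicator (cbox a b) x * g x))
            \<le> \<bar>indicator (cbox a b) x * g x\<bar>"
          unfolding real_norm_def abs_mult[of "box_bump a b n x"]
          by (intro mult_left_le_one_le) auto
      qed
    qed
    moreover have "(\<integral>x. box_bump a b n x * (indicator (cbox a b) x * g x) \<partial>lebesgue) = 0" for n
    proof -
      have "(\<lambda>x. box_bump a b n x * (indicator (cbox a b) x * g x)) =
          (\<lambda>x. indicator \<Omega> x *\<^sub>R (g x * box_bump a b n x))"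
      proof
        fix x
        show "box_bump a b n x * (indicator (cbox a b) x * g x) =
            indicator \<Omega> x *\<^sub>R (g x * box_bump a b n x)"
        proof (cases "x \<in> box a b")
          case True
          then have "x \<in> cbox a b" "x \<in> \<Omega>"
            using box_subset_cbox[of a b] that by blast+
          then show ?thesis by simp
        qed (simp add: box_bump_eq_0)
      qed
      then show ?thesis
        using orth[OF box_bump_test_function[OF that, of n]] by (simp add: integral_restrict_space)
    qed
    moreover have "(\<lambda>x. indicator (box a b) x * (indicator (cbox a b) x * g x)) =
        (\<lambda>x. indicator (box a b) x * g x)"
      using box_subset_cbox[of a b] by (auto simp: fun_eq_iff indicator_def)
    ultimately show ?thesis
      by (simp add: LIMSEQ_const_iff)
  qed
  have ae: "AE x in lebesgue. x \<in> cbox a b \<longrightarrow> g x = 0" if sub: "cbox a b \<subseteq> \<Omega>" for a b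
  proof -
    let ?h = "\<lambda>x. indicator (box a b) x * g x"
    have h: "integrable lebesgue ?h" using box_int[OF sub] .
    \<comment> \<open>The criterion for boxes lives on \<open>lborel\<close>, while \<open>g\<close>
      is only Lebesgue measurable; hence a Borel representative.\<close>
    obtain h' where h'[measurable]: "h' \<in> borel_measurable lborel" and "AE x in lborel. ?h x = h' x"
      using completion_ex_borel_measurable_real[OF borel_measurable_integrable[OF h]] by blast
    then have eq: "AE x in lebesgue. ?h x = h' x" by (simp add: AE_completion)
    have h'_leb: "h' \<in> borel_measurable lebesgue"
      using h' by (rule measurable_completion)
    have "integrable lebesgue h'"
      using integrable_cong_AE[OF borel_measurable_integrable[OF h] h'_leb eq] h by simp
    then have int: "integrable lborel h'"
      using h' by (simp add: integrable_completion)
    have set0: "(\<integral>x. indicator (box c d) x * h' x \<partial>lborel) = 0" for c d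
    proof -
      have "(\<integral>x. indicator (box c d) x * h' x \<partial>lborel) = (\<integral>x. indicator (box c d) x * h' x \<partial>lebesgue)"
        by (rule integral_completion[symmetric]) measurable
      also have "\<dots> = (\<integral>x. indicator (box c d) x * ?h x \<partial>lebesgue)"
      proof (rule integral_cong_AE)
        have [measurable]: "(indicator (box c d) :: 'a \<Rightarrow> real) \<in> borel_measurable lebesgue"
          by (intro borel_measurable_indicator) auto
        note [measurable] = h'_leb borel_measurable_integrable[OF h]
        show "(\<lambda>x. indicator (box c d) x * h' x) \<in> borel_measurable lebesgue"
          "(\<lambda>x. indicator (box c d) x * ?h x) \<in> borel_measurable lebesgue"
          by measurable
        show "AE x in lebesgue. indicator (box c d) x * h' x = indicator (box c d) x * ?h x"
          using eq by eventually_elim simp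
      qed
      also have "\<dots> = (\<integral>x. indicator (box c d \<inter> box a b) x * g x \<partial>lebesgue)"
        by (simp add: indicator_inter_arith mult.assoc)
      also have "\<dots> = 0"
      \<comment> \<open>An empty \<open>box p q\<close> may still have a nonempty
        \<open>cbox p q\<close>, possibly outside \<open>\<Omega>\<close>. Only for a nonempty box
        is the closed box its closure, hence contained in \<open>cbox a b\<close>.\<close>
      proof (cases "box c d \<inter> box a b = {}")
        case False
        obtain p q where pq: "box c d \<inter> box a b = box p q"
          using box_Int_box[of c d a b] by (rule that)
        with False have "box p q \<noteq> {}" "box a b \<noteq> {}" "box p q \<subseteq> box a b" by auto
        then have "cbox p q \<subseteq> cbox a b"
          using closure_mono[of "box p q" "box a b"] by (simp add: closure_box)
        then show ?thesis
          using box0[of p q] sub pq by auto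
      qed simp
      finally show ?thesis .
    qed
    have "(\<integral>x. h' x \<partial>lborel) = (\<integral>x. h' x \<partial>lebesgue)"
      by (rule integral_completion[symmetric]) (rule h')
    also have "\<dots> = (\<integral>x. ?h x \<partial>lebesgue)"
      by (rule integral_cong_AE[OF borel_measurable_integrable[OF h] h'_leb eq, symmetric])
    also have "\<dots> = 0" by (rule box0[OF sub])
    finally have "AE x in lborel. h' x = 0"
      by (rule AE_lborel_eq_0_if_integral_box_eq_0[OF int])
         (unfold set_lebesgue_integral_def real_scaleR_def, rule set0)
    then have "AE x in lebesgue. h' x = 0" by (rule AE_completion)
    \<comment> \<open>The information so far concerns the open box; its boundary is a null
      set.\<close>
    moreover have "AE x in lebesgue. x \<notin> cbox a b - box a b"
      by (intro AE_not_in) (simp add: negligible_iff_null_sets[symmetric] negligible_frontier_interval)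
    ultimately show ?thesis
      using eq
    proof eventually_elim
      case (elim x)
      then show ?case by (cases "x \<in> box a b") simp_all
    qed
  qed
  \<comment> \<open>Closed boxes are needed to cover \<open>\<Omega>\<close> by countably many, so
    that the exceptional null sets can be united.\<close>
  obtain \<D> where \<D>: "countable \<D>" "\<D> \<subseteq> Pow \<Omega>" "\<forall>X\<in>\<D>. \<exists>a b. X = cbox a b" "\<Union>\<D> = \<Omega>"
    using open_countable_Union_open_cbox[OF \<open>open \<Omega>\<close>] by (metis (no_types, lifting))
  have "AE x in lebesgue. \<forall>X\<in>\<D>. x \<in> X \<longrightarrow> g x = 0"
  proof (subst AE_ball_countable[OF \<D>(1)], rule ballI)
    fix X assume "X \<in> \<D>"
    then obtain a b where "X = cbox a b" using bspec[OF \<D>(3)] by blast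
    moreover have "X \<subseteq> \<Omega>" using \<open>X \<in> \<D>\<close> \<D>(2) by blast
    ultimately show "AE x in lebesgue. x \<in> X \<longrightarrow> g x = 0"
      using ae[of a b] by simp
  qed
  then have "AE x in lebesgue. x \<in> \<Omega> \<longrightarrow> g x = 0"
    by eventually_elim (metis UnionE \<D>(4))
  then show ?thesis
    by (simp add: AE_restrict_space_iff)
qed

subsection \<open>Weak partial derivatives\<close>

lemma L1_loc_lincomb:
  "f \<in> L1_loc \<Omega> \<Longrightarrow> g \<in> L1_loc \<Omega> \<Longrightarrow> (\<lambda>x. a * f x + b * g x) \<in> L1_loc \<Omega>"
  unfolding L1_loc_def by simp

text \<open>On the compact support of \<open>\<phi>\<close>, \<open>f\<close> is integrable and
  \<open>\<phi>\<close> is bounded. Additivity of the integrals defining weak derivatives depends on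
  this.\<close>

lemma L1_loc_test_integrable:
  assumes "open \<Omega>" and f: "f \<in> L1_loc \<Omega>" and \<phi>: "\<phi> \<in> test_functions \<Omega>"
  shows "integrable (lebesgue_on \<Omega>) (\<lambda>x. f x * \<phi> x)"
proof -
  obtain K where K: "compact K" "K \<subseteq> \<Omega>" and 0: "\<And>x. x \<notin> K \<Longrightarrow> \<phi> x = 0"
    using test_functionsE[OF \<phi>] by metis
  have cont: "continuous_on UNIV \<phi>"
    using Ck_continuous[OF test_functions_Ck[OF \<phi>]] .
  obtain C where C: "C \<ge> 0" "\<And>x. \<bar>\<phi> x\<bar> \<le> C"
    using bounded_compact_support[OF cont K(1) 0] by blast
  have meas: "\<phi> \<in> borel_measurable lebesgue"
    using borel_measurable_continuous_onI[OF cont] by (intro measurable_completion) simp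
  have "integrable (lebesgue_on K) f"
    using f K unfolding L1_loc_def by blast
  then have int: "integrable lebesgue (\<lambda>x. indicator K x * f x)"
    using K by (simp add: integrable_restrict_space compact_imp_closed)
  have "integrable lebesgue (\<lambda>x. indicator K x * f x * \<phi> x)"
  proof (rule Bochner_Integration.integrable_bound)
    show "integrable lebesgue (\<lambda>x. C * (indicator K x * f x))"
      using int by simp
    show "(\<lambda>x. indicator K x * f x * \<phi> x) \<in> borel_measurable lebesgue"
      by (rule borel_measurable_times[OF borel_measurable_integrable[OF int] meas])
    show "AE x in lebesgue. norm (indicator K x * f x * \<phi> x) \<le> norm (C * (indicator K x * f x))"
    proof (rule AE_I2)
      fix x
      show "norm (indicator K x * f x * \<phi> x) \<le> norm (C * (indicator K x * f x))"
        using mult_left_mono[OF C(2)[of x] abs_ge_zero[of "indicator K x * f x"]] C(1)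
        by (simp add: abs_mult mult.commute)
    qed
  qed
  moreover have "(\<lambda>x. indicator K x * f x * \<phi> x) = (\<lambda>x. indicator \<Omega> x *\<^sub>R (f x * \<phi> x))"
  proof
    fix x
    show "indicator K x * f x * \<phi> x = indicator \<Omega> x *\<^sub>R (f x * \<phi> x)"
      using K(2) 0[of x] by (cases "x \<in> K") auto
  qed
  ultimately show ?thesis
    using \<open>open \<Omega>\<close> by (simp add: integrable_restrict_space)
qed

lemma has_weak_partial_lincomb:
  assumes "open \<Omega>" and i: "i \<in> Basis"
    and f: "has_weak_partial \<Omega> i f f'" and g: "has_weak_partial \<Omega> i g g'"
  shows "has_weak_partial \<Omega> i (\<lambda>x. a * f x + b * g x) (\<lambda>x. a * f' x + b * g' x)"
  unfolding has_weak_partial_def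
proof (intro conjI ballI)
  fix \<phi> assume \<phi>: "\<phi> \<in> test_functions \<Omega>"
  note [simp] = L1_loc_test_integrable[OF \<open>open \<Omega>\<close> _ \<phi>]
    L1_loc_test_integrable[OF \<open>open \<Omega>\<close> _ test_functions_pd[OF \<phi> i]]
  have [simp]: "f \<in> L1_loc \<Omega>" "f' \<in> L1_loc \<Omega>" "g \<in> L1_loc \<Omega>" "g' \<in> L1_loc \<Omega>"
    using f g by (simp_all add: has_weak_partial_def)
  have "(\<integral>x. f x * pd i \<phi> x \<partial>lebesgue_on \<Omega>) = - (\<integral>x. f' x * \<phi> x \<partial>lebesgue_on \<Omega>)"
    "(\<integral>x. g x * pd i \<phi> x \<partial>lebesgue_on \<Omega>) = - (\<integral>x. g' x * \<phi> x \<partial>lebesgue_on \<Omega>)"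
    using f g \<phi> by (simp_all add: has_weak_partial_def)
  then show "(\<integral>x. (a * f x + b * g x) * pd i \<phi> x \<partial>lebesgue_on \<Omega>) =
      - (\<integral>x. (a * f' x + b * g' x) * \<phi> x \<partial>lebesgue_on \<Omega>)"
    by (simp add: distrib_right mult.assoc)
qed (use f g in \<open>auto simp: has_weak_partial_def intro!: L1_loc_lincomb\<close>)

lemma has_weak_partial_unique:
  assumes "open \<Omega>" and f: "has_weak_partial \<Omega> i f g" and f': "has_weak_partial \<Omega> i f h"
  shows "AE x in lebesgue_on \<Omega>. g x = h x"
proof -
  have L: "g \<in> L1_loc \<Omega>" "h \<in> L1_loc \<Omega>"
    using f f' by (simp_all add: has_weak_partial_def)
  have "AE x in lebesgue_on \<Omega>. 1 * g x + (- 1) * h x = 0"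
  proof (rule AE_eq_0_if_orthogonal_test_functions[OF \<open>open \<Omega>\<close> L1_loc_lincomb[OF L]])
    fix \<phi> assume \<phi>: "\<phi> \<in> test_functions \<Omega>"
    note [simp] = L1_loc_test_integrable[OF \<open>open \<Omega>\<close> _ \<phi>]
    have "(\<integral>x. g x * \<phi> x \<partial>lebesgue_on \<Omega>) = (\<integral>x. h x * \<phi> x \<partial>lebesgue_on \<Omega>)"
      using f f' \<phi> by (simp add: has_weak_partial_def)
    then show "(\<integral>x. (1 * g x + (- 1) * h x) * \<phi> x \<partial>lebesgue_on \<Omega>) = 0"
      using L by (simp add: left_diff_distrib)
  qed
  then show ?thesis by eventually_elim simp
qed

lemma continuous_imp_L1_loc:
  fixes f :: "'a::euclidean_space \<Rightarrow> real"
  assumes "continuous_on UNIV f"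
  shows "f \<in> L1_loc \<Omega>"
  unfolding L1_loc_def
proof (intro CollectI allI impI)
  fix K assume "compact K \<and> K \<subseteq> \<Omega>"
  then have K: "compact K" "K \<in> sets borel" "K \<in> sets lebesgue"
    by (auto simp: compact_imp_closed)
  have "integrable lborel (\<lambda>x. indicator K x *\<^sub>R f x)"
    using assms K by (intro borel_integrable_compact continuous_on_subset[OF assms]) auto
  from borel_measurable_integrable[OF this] this
  have "integrable lebesgue (\<lambda>x. indicator K x *\<^sub>R f x)"
    by (simp only: integrable_completion)
  then show "integrable (lebesgue_on K) f"
    using K by (simp add: integrable_restrict_space)
qed

lemma has_weak_partial_classical:
  assumes "open \<Omega>" and f: "Ck (Suc k) f" and i: "i \<in> Basis"
  shows "has_weak_partial \<Omega> i f (pd i f)"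
  unfolding has_weak_partial_def
proof (intro conjI ballI)
  note cont = Ck_continuous[OF f] Ck_continuous[OF Ck_pd[OF f i]]
  show "f \<in> L1_loc \<Omega>" "pd i f \<in> L1_loc \<Omega>"
    by (intro continuous_imp_L1_loc cont)+
  fix \<phi> assume \<phi>: "\<phi> \<in> test_functions \<Omega>"
  obtain K where K: "K \<subseteq> \<Omega>" "\<And>x. x \<notin> K \<Longrightarrow> \<phi> x = 0" "\<And>x. x \<notin> K \<Longrightarrow> pd i \<phi> x = 0"
    using test_functionsE[OF \<phi>] by metis
  note cont\<phi> = Ck_continuous[OF test_functions_Ck[OF \<phi>]]
    Ck_continuous[OF test_functions_Ck[OF test_functions_pd[OF \<phi> i]]]
  have "(\<integral>x. f x * pd i \<phi> x \<partial>lebesgue_on \<Omega>) = (\<integral>x. f x * pd i \<phi> x \<partial>lborel)"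
    by (intro integral_lebesgue_on_eq_lborel borel_measurable_continuous_onI continuous_on_mult cont cont\<phi>)
       (use K \<open>open \<Omega>\<close> in auto)
  also have "\<dots> = - (\<integral>x. pd i f x * \<phi> x \<partial>lborel)"
    by (rule integral_by_parts_test[OF f \<phi> i])
  also have "(\<integral>x. pd i f x * \<phi> x \<partial>lborel) = (\<integral>x. pd i f x * \<phi> x \<partial>lebesgue_on \<Omega>)"
    by (intro integral_lebesgue_on_eq_lborel[symmetric] borel_measurable_continuous_onI continuous_on_mult cont cont\<phi>)
       (use K \<open>open \<Omega>\<close> in auto)
  finally show "(\<integral>x. f x * pd i \<phi> x \<partial>lebesgue_on \<Omega>) = - (\<integral>x. pd i f x * \<phi> x \<partial>lebesgue_on \<Omega>)" .
qed

lemma has_weak_partial_weak_partial: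
  "has_weak_partial \<Omega> i f g \<Longrightarrow> has_weak_partial \<Omega> i f (weak_partial \<Omega> i f)"
  unfolding weak_partial_def by (rule someI[where P = "has_weak_partial \<Omega> i f"])

text \<open>This is how the arbitrarily chosen representative is computed: exhibit any weak
  derivative.\<close>

lemma weak_partial_AE_eq:
  "open \<Omega> \<Longrightarrow> has_weak_partial \<Omega> i f g \<Longrightarrow> AE x in lebesgue_on \<Omega>. weak_partial \<Omega> i f x = g x"
  using has_weak_partial_unique has_weak_partial_weak_partial by blast

lemma integral_weak_partial_test:
  "has_weak_partial \<Omega> i f g \<Longrightarrow> \<phi> \<in> test_functions \<Omega> \<Longrightarrow>
    (\<integral>x. pd i \<phi> x * f x \<partial>lebesgue_on \<Omega>) = - (\<integral>x. \<phi> x * g x \<partial>lebesgue_on \<Omega>)"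
  by (simp add: has_weak_partial_def mult.commute)

text \<open>Both weak derivatives of \<open>v\<close> are moved onto the test function, which leaves
  \<open>v\<close> against a mixed second derivative of \<open>\<phi>\<close>. Thus no second weak
  derivatives of \<open>v\<close> enter.\<close>

lemma integral_pd_weak_partial_swap:
  assumes "has_weak_partial \<Omega> i v vi" and "has_weak_partial \<Omega> j v vj"
    and "i \<in> Basis" and "j \<in> Basis" and \<phi>: "\<phi> \<in> test_functions \<Omega>"
  shows "(\<integral>x. pd i \<phi> x * vj x \<partial>lebesgue_on \<Omega>) = (\<integral>x. pd j \<phi> x * vi x \<partial>lebesgue_on \<Omega>)"
proof -
  have "(\<integral>x. pd j (pd i \<phi>) x * v x \<partial>lebesgue_on \<Omega>) = (\<integral>x. pd i (pd j \<phi>) x * v x \<partial>lebesgue_on \<Omega>)"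
    by (simp only: pd_commute[OF test_functions_Ck[OF \<phi>] assms(4,3)])
  then show ?thesis
    using integral_weak_partial_test[OF assms(2) test_functions_pd[OF \<phi> assms(3)]]
      integral_weak_partial_test[OF assms(1) test_functions_pd[OF \<phi> assms(4)]]
    by linarith
qed

subsection \<open>Square-integrable functions\<close>

lemma Lp_1_iff: "f \<in> Lp 1 \<Omega> \<longleftrightarrow> integrable (lebesgue_on \<Omega>) f"
  unfolding Lp_def by (auto intro: integrable_norm_cancel)

lemma Lp_2_iff:
  "f \<in> Lp 2 \<Omega> \<longleftrightarrow> f \<in> borel_measurable (lebesgue_on \<Omega>) \<and> integrable (lebesgue_on \<Omega>) (\<lambda>x. (f x)\<^sup>2)"
  unfolding Lp_def by (simp add: powr_numeral)

text \<open>Lebesgue measure is complete, so a set that differs from a measurable one by a null set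
  is measurable. This carries measurability over to representatives known only almost
  everywhere.\<close>

lemma borel_measurable_lebesgue_on_AE_cong:
  fixes f g :: "'a::euclidean_space \<Rightarrow> real"
  assumes \<Omega>: "\<Omega> \<in> sets lebesgue" and f: "f \<in> borel_measurable (lebesgue_on \<Omega>)"
    and ae: "AE x in lebesgue_on \<Omega>. f x = g x"
  shows "g \<in> borel_measurable (lebesgue_on \<Omega>)"
proof (rule borel_measurable_if_D, rule measurableI)
  let ?f = "\<lambda>x. if x \<in> \<Omega> then f x else 0" and ?g = "\<lambda>x. if x \<in> \<Omega> then g x else 0"
  fix A :: "real set" assume A: "A \<in> sets borel"
  have f': "?f \<in> borel_measurable lebesgue"
    using borel_measurable_if_I[OF f \<Omega>] .
  show "?g -` A \<inter> space lebesgue \<in> sets lebesgue"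
  proof (rule completion.in_sets_AE)
    show "?f -` A \<inter> space lebesgue \<in> sets lebesgue"
      using measurable_sets[OF f' A] .
    have "AE x in lebesgue. x \<in> \<Omega> \<longrightarrow> f x = g x"
      using ae \<Omega> by (simp add: AE_restrict_space_iff)
    then show "AE x in lebesgue. x \<in> ?f -` A \<inter> space lebesgue \<longleftrightarrow> x \<in> ?g -` A \<inter> space lebesgue"
      by eventually_elim simp
  qed simp
qed simp

lemma Lp_AE_cong:
  assumes "\<Omega> \<in> sets lebesgue" and f: "f \<in> Lp p \<Omega>" and ae: "AE x in lebesgue_on \<Omega>. f x = g x"
  shows "g \<in> Lp p \<Omega>"
proof -
  have g: "g \<in> borel_measurable (lebesgue_on \<Omega>)"
    using borel_measurable_lebesgue_on_AE_cong[OF assms(1) _ ae] f by (simp add: Lp_def)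
  have "integrable (lebesgue_on \<Omega>) (\<lambda>x. \<bar>g x\<bar> powr p) \<longleftrightarrow> integrable (lebesgue_on \<Omega>) (\<lambda>x. \<bar>f x\<bar> powr p)"
    by (rule integrable_cong_AE) (use f g ae in \<open>auto simp: Lp_def elim: eventually_mono\<close>)
  with f g show ?thesis by (simp add: Lp_def)
qed

lemma W1_has_weak_partial:
  "u \<in> W1 p \<Omega> \<Longrightarrow> i \<in> Basis \<Longrightarrow> has_weak_partial \<Omega> i u (weak_partial \<Omega> i u)"
  unfolding W1_def by (auto intro: has_weak_partial_weak_partial)

lemma W1_weak_partial_Lp:
  assumes "open \<Omega>" and "u \<in> W1 p \<Omega>" and "i \<in> Basis"
  shows "weak_partial \<Omega> i u \<in> Lp p \<Omega>"
proof -
  obtain g where g: "g \<in> Lp p \<Omega>" "has_weak_partial \<Omega> i u g"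
    using assms by (auto simp: W1_def)
  have ae: "AE x in lebesgue_on \<Omega>. g x = weak_partial \<Omega> i u x"
    using weak_partial_AE_eq[OF \<open>open \<Omega>\<close> g(2)] by eventually_elim simp
  show ?thesis
    by (rule Lp_AE_cong[OF _ g(1) ae]) (simp add: \<open>open \<Omega>\<close>)
qed

lemma Lp_2_mult_integrable:
  assumes "f \<in> Lp 2 \<Omega>" and "g \<in> Lp 2 \<Omega>"
  shows "integrable (lebesgue_on \<Omega>) (\<lambda>x. f x * g x)"
proof (rule Bochner_Integration.integrable_bound)
  show "integrable (lebesgue_on \<Omega>) (\<lambda>x. (f x)\<^sup>2 + (g x)\<^sup>2)"
    using assms by (simp add: Lp_2_iff)
  show "(\<lambda>x. f x * g x) \<in> borel_measurable (lebesgue_on \<Omega>)"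
    using assms by (auto simp: Lp_2_iff intro: borel_measurable_times)
  show "AE x in lebesgue_on \<Omega>. norm (f x * g x) \<le> norm ((f x)\<^sup>2 + (g x)\<^sup>2)"
  proof (rule AE_I2)
    fix x
    have "2 * (\<bar>f x\<bar> * \<bar>g x\<bar>) \<le> (f x)\<^sup>2 + (g x)\<^sup>2"
      using sum_squares_bound[of "\<bar>f x\<bar>" "\<bar>g x\<bar>"] by simp
    moreover have "0 \<le> \<bar>f x\<bar> * \<bar>g x\<bar>" by simp
    ultimately show "norm (f x * g x) \<le> norm ((f x)\<^sup>2 + (g x)\<^sup>2)"
      unfolding real_norm_def abs_mult by linarith
  qed
qed

lemma Lp_2_cmult:
  assumes "f \<in> Lp 2 \<Omega>"
  shows "(\<lambda>x. c * f x) \<in> Lp 2 \<Omega>"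
  using assms by (auto simp: Lp_2_iff power_mult_distrib intro!: borel_measurable_times)

lemma Lp_2_add:
  assumes "f \<in> Lp 2 \<Omega>" and "g \<in> Lp 2 \<Omega>"
  shows "(\<lambda>x. f x + g x) \<in> Lp 2 \<Omega>"
  using assms Lp_2_mult_integrable[OF assms]
  by (auto simp: Lp_2_iff power2_sum mult.assoc intro!: borel_measurable_add)

lemma Lp_2_diff:
  assumes "f \<in> Lp 2 \<Omega>" and "g \<in> Lp 2 \<Omega>"
  shows "(\<lambda>x. f x - g x) \<in> Lp 2 \<Omega>"
  using Lp_2_add[OF assms(1) Lp_2_cmult[OF assms(2), of "- 1"]] by simp

lemma Lp_2_bounded_mult:
  assumes h: "h \<in> borel_measurable (lebesgue_on \<Omega>)" and C: "\<And>x. \<bar>h x\<bar> \<le> C" and f: "f \<in> Lp 2 \<Omega>"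
  shows "(\<lambda>x. h x * f x) \<in> Lp 2 \<Omega>"
    and "(\<integral>x. (h x * f x)\<^sup>2 \<partial>lebesgue_on \<Omega>) \<le> C\<^sup>2 * (\<integral>x. (f x)\<^sup>2 \<partial>lebesgue_on \<Omega>)"
proof -
  have *: "(h x * f x)\<^sup>2 \<le> C\<^sup>2 * (f x)\<^sup>2" for x
    unfolding power_mult_distrib
    using power_mono[OF C[of x] abs_ge_zero, of 2] by (intro mult_right_mono) auto
  have m: "(\<lambda>x. h x * f x) \<in> borel_measurable (lebesgue_on \<Omega>)"
    using h f by (auto simp: Lp_2_iff intro: borel_measurable_times)
  have int: "integrable (lebesgue_on \<Omega>) (\<lambda>x. C\<^sup>2 * (f x)\<^sup>2)"
    using f by (simp add: Lp_2_iff)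
  have int': "integrable (lebesgue_on \<Omega>) (\<lambda>x. (h x * f x)\<^sup>2)"
    by (rule Bochner_Integration.integrable_bound[OF int])
       (use m * in \<open>auto intro!: borel_measurable_power\<close>)
  then show "(\<lambda>x. h x * f x) \<in> Lp 2 \<Omega>"
    using m by (simp add: Lp_2_iff)
  show "(\<integral>x. (h x * f x)\<^sup>2 \<partial>lebesgue_on \<Omega>) \<le> C\<^sup>2 * (\<integral>x. (f x)\<^sup>2 \<partial>lebesgue_on \<Omega>)"
    using integral_mono[OF int' int] * by simp
qed

text \<open>The integral of (t f + g)^2 is a polynomial in t of degree at most 2 without negative
  values. If its leading coefficient vanishes, \<open>f\<close> is zero almost everywhere.\<close>

lemma Cauchy_Schwarz_Lp_2:
  assumes f: "f \<in> Lp 2 \<Omega>" and g: "g \<in> Lp 2 \<Omega>"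
  shows "\<bar>\<integral>x. f x * g x \<partial>lebesgue_on \<Omega>\<bar> \<le>
    sqrt (\<integral>x. (f x)\<^sup>2 \<partial>lebesgue_on \<Omega>) * sqrt (\<integral>x. (g x)\<^sup>2 \<partial>lebesgue_on \<Omega>)"
proof -
  let ?M = "lebesgue_on \<Omega>"
  define A where "A = (\<integral>x. (f x)\<^sup>2 \<partial>?M)"
  define B where "B = (\<integral>x. (g x)\<^sup>2 \<partial>?M)"
  define D where "D = (\<integral>x. f x * g x \<partial>?M)"
  have int: "integrable ?M (\<lambda>x. (f x)\<^sup>2)" "integrable ?M (\<lambda>x. (g x)\<^sup>2)" "integrable ?M (\<lambda>x. f x * g x)"
    using f g Lp_2_mult_integrable[OF f g] by (simp_all add: Lp_2_iff)
  have A0: "A \<ge> 0" and B0: "B \<ge> 0" by (simp_all add: A_def B_def)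
  have quad: "0 \<le> t\<^sup>2 * A + 2 * t * D + B" for t
  proof -
    have "0 \<le> (\<integral>x. (t * f x + g x)\<^sup>2 \<partial>?M)" by simp
    also have "\<dots> = (\<integral>x. t\<^sup>2 * (f x)\<^sup>2 + 2 * t * (f x * g x) + (g x)\<^sup>2 \<partial>?M)"
      by (intro Bochner_Integration.integral_cong) (auto simp: power2_eq_square algebra_simps)
    also have "\<dots> = t\<^sup>2 * A + 2 * t * D + B"
      using int by (simp add: A_def B_def D_def)
    finally show ?thesis .
  qed
  have "D\<^sup>2 \<le> A * B"
  proof (cases "A = 0")
    case True
    have "AE x in ?M. (f x)\<^sup>2 = 0"
      using integral_nonneg_eq_0_iff_AE[OF int(1)] True by (simp add: A_def)
    then have "AE x in ?M. f x * g x = 0" by eventually_elim simp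
    then have "D = 0" unfolding D_def by (rule integral_eq_zero_AE)
    with True show ?thesis by simp
  next
    case False
    then have "A > 0" using A0 by simp
    \<comment> \<open>This value of t minimizes the quadratic polynomial.\<close>
    with quad[of "- D / A"] have "0 \<le> B - D\<^sup>2 / A"
      by (simp add: power2_eq_square field_simps)
    with \<open>A > 0\<close> show ?thesis by (simp add: field_simps)
  qed
  then have "\<bar>D\<bar> \<le> sqrt (A * B)"
    by (metis real_sqrt_abs real_sqrt_le_mono)
  then show ?thesis
    by (simp add: A_def B_def D_def real_sqrt_mult)
qed

section \<open>Square integrability on bounded open sets\<close>

lemma bounded_imp_integrable_const:
  fixes c :: real
  assumes "open \<Omega>" and "bounded \<Omega>"
  shows "integrable (lebesgue_on \<Omega>) (\<lambda>_. c)"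
proof -
  have "emeasure lebesgue \<Omega> < \<infinity>"
    using assms emeasure_bounded_finite[of \<Omega>] by simp
  then show ?thesis
    using assms by (simp add: integrable_restrict_space)
qed

lemma Lp_2_const: "open \<Omega> \<Longrightarrow> bounded \<Omega> \<Longrightarrow> (\<lambda>_. c) \<in> Lp 2 \<Omega>"
  by (simp add: Lp_2_iff bounded_imp_integrable_const)

lemma Lp_2_imp_integrable:
  "open \<Omega> \<Longrightarrow> bounded \<Omega> \<Longrightarrow> f \<in> Lp 2 \<Omega> \<Longrightarrow> integrable (lebesgue_on \<Omega>) f"
  using Lp_2_mult_integrable[OF Lp_2_const[of \<Omega> 1]] by simp

text \<open>Cauchy-Schwarz against the constant 1, which is square integrable because
  \<open>\<Omega>\<close> has finite measure.\<close>

lemma integral_abs_le_Lp_2: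
  assumes "open \<Omega>" and "bounded \<Omega>" and f: "f \<in> Lp 2 \<Omega>"
  shows "(\<integral>x. \<bar>f x\<bar> \<partial>lebesgue_on \<Omega>) \<le>
    sqrt (\<integral>x. 1 \<partial>lebesgue_on \<Omega>) * sqrt (\<integral>x. (f x)\<^sup>2 \<partial>lebesgue_on \<Omega>)"
proof -
  have "(\<lambda>x. \<bar>f x\<bar>) \<in> Lp 2 \<Omega>"
    using f by (auto simp: Lp_2_iff intro: borel_measurable_abs)
  from Cauchy_Schwarz_Lp_2[OF Lp_2_const[OF assms(1,2), of 1] this]
  show ?thesis by simp
qed

lemma Lp_2_sum:
  assumes "finite I" and "open \<Omega>" and "bounded \<Omega>" and "\<And>j. j \<in> I \<Longrightarrow> f j \<in> Lp 2 \<Omega>"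
  shows "(\<lambda>x. \<Sum>j\<in>I. f j x) \<in> Lp 2 \<Omega>"
  using assms(1,4) by (induction I rule: finite_induct) (auto intro: Lp_2_add Lp_2_const assms(2,3))

lemma test_function_Lp_2:
  assumes "open \<Omega>" and \<phi>: "\<phi> \<in> test_functions \<Omega>"
  shows "\<phi> \<in> Lp 2 \<Omega>"
proof -
  have cont: "continuous_on UNIV \<phi>"
    using Ck_continuous[OF test_functions_Ck[OF \<phi>]] .
  have "\<phi> \<in> borel_measurable (lebesgue_on \<Omega>)"
    using borel_measurable_continuous_onI[OF cont]
    by (intro measurable_restrict_space1 measurable_completion) simp
  moreover have "integrable (lebesgue_on \<Omega>) (\<lambda>x. \<phi> x * \<phi> x)"
    by (rule L1_loc_test_integrable[OF \<open>open \<Omega>\<close> continuous_imp_L1_loc[OF cont] \<phi>])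
  ultimately show ?thesis
    by (simp add: Lp_2_iff power2_eq_square)
qed

subsection \<open>Approximation by test functions\<close>

text \<open>\<open>W1_norm\<close> involves the chosen weak partials of \<open>w - \<phi>\<close>.
  Uniqueness trades them for weak partials of \<open>w\<close> minus classical ones of
  \<open>\<phi>\<close>, and each nonnegative summand is bounded by the whole sum.\<close>

lemma W1_0_2_approx:
  assumes "open \<Omega>" and w: "w \<in> W1_0 2 \<Omega>" and "\<epsilon> > 0"
  obtains \<phi> where "\<phi> \<in> test_functions \<Omega>"
    and "sqrt (\<integral>x. (w x - \<phi> x)\<^sup>2 \<partial>lebesgue_on \<Omega>) < \<epsilon>"
    and "\<forall>i\<in>Basis. sqrt (\<integral>x. (weak_partial \<Omega> i w x - pd i \<phi> x)\<^sup>2 \<partial>lebesgue_on \<Omega>) < \<epsilon>"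
proof -
  let ?M = "lebesgue_on \<Omega>"
  have W: "w \<in> W1 2 \<Omega>" using w by (simp add: W1_0_def)
  obtain \<phi> where \<phi>: "\<phi> \<in> test_functions \<Omega>" and less: "W1_norm 2 \<Omega> (\<lambda>x. w x - \<phi> x) < \<epsilon>"
    using w \<open>\<epsilon> > 0\<close> by (auto simp: W1_0_def)
  let ?z = "\<lambda>x. w x - \<phi> x"
  let ?I = "\<integral>x. (?z x)\<^sup>2 \<partial>?M" and ?J = "\<lambda>i. \<integral>x. (weak_partial \<Omega> i ?z x)\<^sup>2 \<partial>?M"
  have nn: "0 \<le> ?I" "\<And>i. 0 \<le> ?J i" by simp_all
  have norm: "W1_norm 2 \<Omega> ?z = sqrt (?I + (\<Sum>i\<in>Basis. ?J i))"
    unfolding W1_norm_def by (simp add: powr_numeral powr_half_sqrt sum_nonneg)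
  have I: "sqrt ?I < \<epsilon>"
    using less nn unfolding norm
    by (elim le_less_trans[rotated]) (simp add: sum_nonneg)
  have J: "sqrt (\<integral>x. (weak_partial \<Omega> i w x - pd i \<phi> x)\<^sup>2 \<partial>?M) < \<epsilon>" if i: "i \<in> Basis" for i
  proof -
    have "has_weak_partial \<Omega> i (\<lambda>x. 1 * w x + (- 1) * \<phi> x)
        (\<lambda>x. 1 * weak_partial \<Omega> i w x + (- 1) * pd i \<phi> x)"
      by (intro has_weak_partial_lincomb[OF \<open>open \<Omega>\<close> i] W1_has_weak_partial[OF W i]
          has_weak_partial_classical[OF \<open>open \<Omega>\<close> test_functions_Ck[OF \<phi>] i])
    then have hwp: "has_weak_partial \<Omega> i ?z (\<lambda>x. weak_partial \<Omega> i w x - pd i \<phi> x)"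
      by simp
    have ae: "AE x in ?M. weak_partial \<Omega> i ?z x = weak_partial \<Omega> i w x - pd i \<phi> x"
      by (rule weak_partial_AE_eq[OF \<open>open \<Omega>\<close> hwp])
    have L: "(\<lambda>x. weak_partial \<Omega> i w x - pd i \<phi> x) \<in> Lp 2 \<Omega>"
      by (intro Lp_2_diff W1_weak_partial_Lp[OF \<open>open \<Omega>\<close> W i]
          test_function_Lp_2[OF \<open>open \<Omega>\<close> test_functions_pd[OF \<phi> i]])
    have L': "weak_partial \<Omega> i ?z \<in> Lp 2 \<Omega>"
    proof (rule Lp_AE_cong[OF _ L])
      show "\<Omega> \<in> sets lebesgue" using \<open>open \<Omega>\<close> by simp
      show "AE x in ?M. weak_partial \<Omega> i w x - pd i \<phi> x = weak_partial \<Omega> i ?z x"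
        using ae by eventually_elim simp
    qed
    have "?J i = (\<integral>x. (weak_partial \<Omega> i w x - pd i \<phi> x)\<^sup>2 \<partial>?M)"
    proof (rule integral_cong_AE)
      show "AE x in ?M. (weak_partial \<Omega> i ?z x)\<^sup>2 = (weak_partial \<Omega> i w x - pd i \<phi> x)\<^sup>2"
        using ae by eventually_elim simp
    qed (use L L' in \<open>auto simp: Lp_2_iff\<close>)
    moreover have "?J i \<le> (\<Sum>i\<in>Basis. ?J i)"
      by (rule member_le_sum) (use i in auto)
    then have "sqrt (?J i) \<le> sqrt (?I + (\<Sum>i\<in>Basis. ?J i))"
      using nn(1) by (intro real_sqrt_le_mono) linarith
    from this less[unfolded norm] have "sqrt (?J i) < \<epsilon>"
      by (rule le_less_trans)
    ultimately show ?thesis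
      by (simp only:)
  qed
  show thesis
    using that[OF \<phi> I] J by blast
qed

text \<open>Makes multiples of \<open>u - v\<close> admissible variations in
  \<open>minimizer\<close>. On a bounded set the L^2 norm controls the L^1 norm, so test functions
  approximating in the former do so in the latter.\<close>

lemma W1_0_1_cmult_W1_0_2:
  assumes "open \<Omega>" and "bounded \<Omega>" and w: "w \<in> W1_0 2 \<Omega>"
  shows "(\<lambda>x. c * w x) \<in> W1_0 1 \<Omega>"
proof -
  let ?M = "lebesgue_on \<Omega>"
  note wp = W1_has_weak_partial[of w 2 \<Omega>]
  have W: "w \<in> W1 2 \<Omega>" using w by (simp add: W1_0_def)
  then have w2: "w \<in> Lp 2 \<Omega>" by (simp add: W1_def)
  have hwp: "has_weak_partial \<Omega> i (\<lambda>x. c * w x) (\<lambda>x. c * weak_partial \<Omega> i w x)" if "i \<in> Basis" for i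
    using has_weak_partial_lincomb[OF \<open>open \<Omega>\<close> that wp[OF W that] wp[OF W that], of c 0] by simp
  have "(\<lambda>x. c * w x) \<in> W1 1 \<Omega>"
    unfolding W1_def
  proof (intro CollectI conjI ballI, goal_cases)
    case 1
    show ?case
      unfolding Lp_1_iff by (intro Lp_2_imp_integrable[OF assms(1,2)] Lp_2_cmult w2)
  next
    case (2 i)
    have "(\<lambda>x. c * weak_partial \<Omega> i w x) \<in> Lp 1 \<Omega>"
      unfolding Lp_1_iff
      by (intro Lp_2_imp_integrable[OF assms(1,2)] Lp_2_cmult W1_weak_partial_Lp[OF assms(1) W 2])
    then show ?case using hwp[OF 2] by blast
  qed
  moreover have "\<exists>\<psi>\<in>test_functions \<Omega>. W1_norm 1 \<Omega> (\<lambda>x. c * w x - \<psi> x) < \<epsilon>" if "\<epsilon> > 0" for \<epsilon>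
  proof -
    define S where "S = sqrt (\<integral>x. 1 \<partial>?M)"
    \<comment> \<open>\<open>W1_norm 1\<close> adds \<open>1 + DIM('a)\<close> integrals, each at
      most \<open>\<bar>c\<bar> * S * \<delta>\<close>. The additional 1 in
      \<open>\<bar>c\<bar> * S + 1\<close> keeps the denominator positive when \<open>c\<close> or
      \<open>S\<close> is zero and makes the final inequality strict.\<close>
    define \<delta> where "\<delta> = \<epsilon> / ((\<bar>c\<bar> * S + 1) * (1 + real DIM('a)))"
    have S: "S \<ge> 0" by (simp add: S_def)
    then have pos: "(\<bar>c\<bar> * S + 1) * (1 + real DIM('a)) > 0"
      by (intro mult_pos_pos add_nonneg_pos) auto
    then have "\<delta> > 0" using \<open>\<epsilon> > 0\<close> by (simp add: \<delta>_def)
    obtain \<phi> where \<phi>: "\<phi> \<in> test_functions \<Omega>"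
      and I: "sqrt (\<integral>x. (w x - \<phi> x)\<^sup>2 \<partial>?M) < \<delta>"
      and J: "\<forall>i\<in>Basis. sqrt (\<integral>x. (weak_partial \<Omega> i w x - pd i \<phi> x)\<^sup>2 \<partial>?M) < \<delta>"
      by (rule W1_0_2_approx[OF \<open>open \<Omega>\<close> w \<open>\<delta> > 0\<close>])
    let ?z = "\<lambda>x. c * w x - c * \<phi> x"
    have le: "(\<integral>x. \<bar>c * f x\<bar> \<partial>?M) \<le> \<bar>c\<bar> * S * \<delta>"
      if f: "f \<in> Lp 2 \<Omega>" "sqrt (\<integral>x. (f x)\<^sup>2 \<partial>?M) < \<delta>" for f
    proof -
      have "(\<integral>x. \<bar>c * f x\<bar> \<partial>?M) = \<bar>c\<bar> * (\<integral>x. \<bar>f x\<bar> \<partial>?M)"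
        by (simp add: abs_mult)
      also have "\<dots> \<le> \<bar>c\<bar> * (S * sqrt (\<integral>x. (f x)\<^sup>2 \<partial>?M))"
        unfolding S_def by (intro mult_left_mono integral_abs_le_Lp_2 assms f) auto
      also have "\<dots> \<le> \<bar>c\<bar> * (S * \<delta>)"
        using S f by (intro mult_left_mono) auto
      finally show ?thesis by (simp add: mult.assoc)
    qed
    have "(\<integral>x. \<bar>?z x\<bar> \<partial>?M) \<le> \<bar>c\<bar> * S * \<delta>"
      using le[OF Lp_2_diff[OF w2 test_function_Lp_2[OF \<open>open \<Omega>\<close> \<phi>]] I]
      by (simp add: right_diff_distrib)
    moreover have "(\<integral>x. \<bar>weak_partial \<Omega> i ?z x\<bar> \<partial>?M) \<le> \<bar>c\<bar> * S * \<delta>" if i: "i \<in> Basis" for i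
    proof -
      let ?d = "\<lambda>x. c * (weak_partial \<Omega> i w x - pd i \<phi> x)"
      have L: "(\<lambda>x. weak_partial \<Omega> i w x - pd i \<phi> x) \<in> Lp 2 \<Omega>"
        by (intro Lp_2_diff W1_weak_partial_Lp[OF \<open>open \<Omega>\<close> W i]
            test_function_Lp_2[OF \<open>open \<Omega>\<close> test_functions_pd[OF \<phi> i]])
      have "has_weak_partial \<Omega> i (\<lambda>x. c * w x + (- c) * \<phi> x)
          (\<lambda>x. c * weak_partial \<Omega> i w x + (- c) * pd i \<phi> x)"
        by (intro has_weak_partial_lincomb[OF \<open>open \<Omega>\<close> i] wp[OF W i]
            has_weak_partial_classical[OF \<open>open \<Omega>\<close> test_functions_Ck[OF \<phi>] i])
      then have "has_weak_partial \<Omega> i ?z ?d"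
        by (simp add: right_diff_distrib)
      then have ae: "AE x in ?M. weak_partial \<Omega> i ?z x = ?d x"
        by (rule weak_partial_AE_eq[OF \<open>open \<Omega>\<close>])
      have m: "?d \<in> borel_measurable ?M"
        using Lp_2_cmult[OF L, of c] by (simp add: Lp_2_iff)
      have m': "weak_partial \<Omega> i ?z \<in> borel_measurable ?M"
      proof (rule borel_measurable_lebesgue_on_AE_cong[OF _ m])
        show "\<Omega> \<in> sets lebesgue" using \<open>open \<Omega>\<close> by simp
        show "AE x in ?M. ?d x = weak_partial \<Omega> i ?z x"
          using ae by eventually_elim simp
      qed
      have "AE x in ?M. \<bar>weak_partial \<Omega> i ?z x\<bar> = \<bar>?d x\<bar>"
        using ae by eventually_elim simp
      then have "(\<integral>x. \<bar>weak_partial \<Omega> i ?z x\<bar> \<partial>?M) = (\<integral>x. \<bar>?d x\<bar> \<partial>?M)"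
        by (rule integral_cong_AE[OF borel_measurable_abs[OF m'] borel_measurable_abs[OF m]])
      with le[OF L bspec[OF J i]] show ?thesis by simp
    qed
    ultimately have "W1_norm 1 \<Omega> ?z \<le> \<bar>c\<bar> * S * \<delta> + (\<Sum>i\<in>(Basis :: 'a set). \<bar>c\<bar> * S * \<delta>)"
      unfolding W1_norm_def by (simp add: sum_nonneg del: sum_constant) (intro add_mono sum_mono)
    also have "\<dots> = (\<bar>c\<bar> * S) * (1 + real DIM('a)) * \<delta>"
      by (simp add: algebra_simps)
    also have "\<dots> < (\<bar>c\<bar> * S + 1) * (1 + real DIM('a)) * \<delta>"
      using \<open>\<delta> > 0\<close> by (intro mult_strict_right_mono) auto
    also have "\<dots> = \<epsilon>"
      using pos unfolding \<delta>_def by (metis less_irrefl nonzero_mult_div_cancel_left times_divide_eq_right)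
    finally show ?thesis
      by (rule bexI[OF _ test_functions_cmult[OF \<phi>]])
  qed
  ultimately show ?thesis
    unfolding W1_0_def by blast
qed

section \<open>Linear combinations in \<open>W1 2\<close>\<close>

lemma W1_2_lincomb:
  assumes "open \<Omega>" and u: "u \<in> W1 2 \<Omega>" and v: "v \<in> W1 2 \<Omega>"
  shows "(\<lambda>x. a * u x + b * v x) \<in> W1 2 \<Omega>"
  unfolding W1_def
proof (intro CollectI conjI ballI)
  show "(\<lambda>x. a * u x + b * v x) \<in> Lp 2 \<Omega>"
    using u v by (intro Lp_2_add Lp_2_cmult) (simp_all add: W1_def)
  fix i :: 'a assume i: "i \<in> Basis"
  have "has_weak_partial \<Omega> i (\<lambda>x. a * u x + b * v x)
      (\<lambda>x. a * weak_partial \<Omega> i u x + b * weak_partial \<Omega> i v x)"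
    by (intro has_weak_partial_lincomb W1_has_weak_partial[OF u i] W1_has_weak_partial[OF v i] assms(1) i)
  moreover have "(\<lambda>x. a * weak_partial \<Omega> i u x + b * weak_partial \<Omega> i v x) \<in> Lp 2 \<Omega>"
    by (intro Lp_2_add Lp_2_cmult W1_weak_partial_Lp[OF \<open>open \<Omega>\<close> u i] W1_weak_partial_Lp[OF \<open>open \<Omega>\<close> v i])
  ultimately show "\<exists>g\<in>Lp 2 \<Omega>. has_weak_partial \<Omega> i (\<lambda>x. a * u x + b * v x) g"
    by blast
qed

lemma weak_grad_lincomb_AE:
  assumes "open \<Omega>" and u: "u \<in> W1 2 \<Omega>" and v: "v \<in> W1 2 \<Omega>"
  shows "AE x in lebesgue_on \<Omega>. weak_grad \<Omega> (\<lambda>x. a * u x + b * v x) x =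
    a *\<^sub>R weak_grad \<Omega> u x + b *\<^sub>R weak_grad \<Omega> v x"
proof -
  have "AE x in lebesgue_on \<Omega>. \<forall>i\<in>Basis. weak_partial \<Omega> i (\<lambda>x. a * u x + b * v x) x =
      a * weak_partial \<Omega> i u x + b * weak_partial \<Omega> i v x"
    by (intro AE_finite_allI finite_Basis weak_partial_AE_eq has_weak_partial_lincomb
        W1_has_weak_partial[OF u] W1_has_weak_partial[OF v] assms(1))
  then show ?thesis
    by eventually_elim
       (simp add: weak_grad_def scaleR_sum_right scaleR_add_left sum.distrib)
qed

subsection \<open>Consequences of minimality\<close>

lemma integrable_weak_grad_add:
  assumes "open \<Omega>" and "bounded \<Omega>" and F: "F \<in> W1_vec 2 \<Omega>" and u: "u \<in> W1 2 \<Omega>"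
  shows "integrable (lebesgue_on \<Omega>) (\<lambda>x. weak_grad \<Omega> u x + F x)"
proof -
  have "integrable (lebesgue_on \<Omega>) (\<lambda>x. weak_partial \<Omega> i u x + F x \<bullet> i)" if "i \<in> Basis" for i
    by (intro Lp_2_imp_integrable[OF assms(1,2)] Lp_2_add W1_weak_partial_Lp[OF assms(1) u that])
       (use F that in \<open>auto simp: W1_vec_def W1_def\<close>)
  then have "integrable (lebesgue_on \<Omega>) (\<lambda>x. \<Sum>i\<in>Basis. (weak_partial \<Omega> i u x + F x \<bullet> i) *\<^sub>R i)"
    by (intro Bochner_Integration.integrable_sum integrable_scaleR_left)
  then show ?thesis
    by (simp add: weak_grad_def scaleR_add_left sum.distrib euclidean_representation)
qed

lemma integrable_Linf_mult:
  assumes H: "H \<in> Linf \<Omega>" and u: "integrable (lebesgue_on \<Omega>) u"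
  shows "integrable (lebesgue_on \<Omega>) (\<lambda>x. H x * u x)"
proof -
  obtain C where C: "AE x in lebesgue_on \<Omega>. \<bar>H x\<bar> \<le> C" and m: "H \<in> borel_measurable (lebesgue_on \<Omega>)"
    using H by (auto simp: Linf_def)
  show ?thesis
  proof (rule Bochner_Integration.integrable_bound)
    show "integrable (lebesgue_on \<Omega>) (\<lambda>x. C * u x)" using u by simp
    show "(\<lambda>x. H x * u x) \<in> borel_measurable (lebesgue_on \<Omega>)"
      by (rule borel_measurable_times[OF m borel_measurable_integrable[OF u]])
    show "AE x in lebesgue_on \<Omega>. norm (H x * u x) \<le> norm (C * u x)"
      using C
    proof eventually_elim
      case (elim x)
      then have "\<bar>H x\<bar> * \<bar>u x\<bar> \<le> \<bar>C\<bar> * \<bar>u x\<bar>" by (intro mult_right_mono) auto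
      then show ?case by (simp add: abs_mult)
    qed
  qed
qed

text \<open>Comparison with the midpoint \<open>m\<close> suffices. The convexity gap
  \<open>?d\<close> is nonnegative almost everywhere, and minimality of both \<open>u\<close> and
  \<open>v\<close> makes its integral at most zero, so it vanishes.\<close>

lemma minimizers_norm_add_eq:
  assumes "open \<Omega>" and "bounded \<Omega>" and H: "H \<in> Linf \<Omega>" and F: "F \<in> W1_vec 2 \<Omega>"
    and u: "u \<in> W1 2 \<Omega>" and v: "v \<in> W1 2 \<Omega>"
    and min_u: "minimizer \<Omega> F H u" and min_v: "minimizer \<Omega> F H v"
    and w: "(\<lambda>x. u x - v x) \<in> W1_0 2 \<Omega>"
  shows "AE x in lebesgue_on \<Omega>. norm ((weak_grad \<Omega> u x + F x) + (weak_grad \<Omega> v x + F x)) =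
    norm (weak_grad \<Omega> u x + F x) + norm (weak_grad \<Omega> v x + F x)"
proof -
  let ?M = "lebesgue_on \<Omega>"
  define m where "m x = 1 / 2 * u x + 1 / 2 * v x" for x
  define E where "E z x = norm (weak_grad \<Omega> z x + F x) + H x * z x" for z x
  have m: "m \<in> W1 2 \<Omega>"
    using W1_2_lincomb[OF \<open>open \<Omega>\<close> u v, of "1 / 2" "1 / 2"] by (simp add: m_def[abs_def])
  have int: "integrable ?M (E z)" if "z \<in> W1 2 \<Omega>" for z
  proof -
    have "integrable ?M z"
      using that by (intro Lp_2_imp_integrable[OF assms(1,2)]) (simp add: W1_def)
    then have "integrable ?M (\<lambda>x. norm (weak_grad \<Omega> z x + F x) + H x * z x)"
      by (intro Bochner_Integration.integrable_add integrable_norm integrable_weak_grad_add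
          integrable_Linf_mult that assms)
    then show ?thesis by (simp add: E_def[abs_def])
  qed
  have energy: "functional \<Omega> F H z = (\<integral>x. E z x \<partial>?M)" for z
    by (simp add: functional_def E_def)
  \<comment> \<open>The midpoint is a variation of either minimizer by a multiple of
    \<open>u - v\<close>.\<close>
  have "m = (\<lambda>x. u x + (- 1 / 2) * (u x - v x))" "m = (\<lambda>x. v x + (1 / 2) * (u x - v x))"
    by (auto simp: m_def fun_eq_iff field_simps)
  then have le: "functional \<Omega> F H u \<le> functional \<Omega> F H m" "functional \<Omega> F H v \<le> functional \<Omega> F H m"
    using min_u min_v W1_0_1_cmult_W1_0_2[OF assms(1,2) w, of "- 1 / 2"]
      W1_0_1_cmult_W1_0_2[OF assms(1,2) w, of "1 / 2"]
    unfolding minimizer_def by metis+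
  let ?d = "\<lambda>x. (1 / 2) * E u x + (1 / 2) * E v x - E m x"
  have d_int: "integrable ?M ?d"
    using int[OF u] int[OF v] int[OF m] by simp
  have "(\<integral>x. ?d x \<partial>?M) = (1 / 2) * (\<integral>x. E u x \<partial>?M) + (1 / 2) * (\<integral>x. E v x \<partial>?M) - (\<integral>x. E m x \<partial>?M)"
    using int[OF u] int[OF v] int[OF m] by simp
  also have "\<dots> \<le> 0"
    using le unfolding energy by simp
  finally have le0: "(\<integral>x. ?d x \<partial>?M) \<le> 0" .
  \<comment> \<open>The terms with \<open>H\<close> are linear and cancel at the midpoint; half the
    defect in the triangle inequality is left.\<close>
  have d_eq: "AE x in ?M. ?d x = (norm (weak_grad \<Omega> u x + F x) + norm (weak_grad \<Omega> v x + F x) -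
      norm ((weak_grad \<Omega> u x + F x) + (weak_grad \<Omega> v x + F x))) / 2"
    using weak_grad_lincomb_AE[OF \<open>open \<Omega>\<close> u v, of "1 / 2" "1 / 2"]
  proof eventually_elim
    case (elim x)
    have "weak_grad \<Omega> m x + F x = (1 / 2) *\<^sub>R ((weak_grad \<Omega> u x + F x) + (weak_grad \<Omega> v x + F x))"
    proof -
      have "F x = (1 / 2) *\<^sub>R (F x + F x)" by (simp add: scaleR_2[symmetric])
      then show ?thesis
        using elim unfolding m_def[abs_def] by (simp add: scaleR_add_right algebra_simps)
    qed
    then have "norm (weak_grad \<Omega> m x + F x) =
        norm ((weak_grad \<Omega> u x + F x) + (weak_grad \<Omega> v x + F x)) / 2"
      by simp
    then show ?case
      by (simp add: E_def m_def field_simps)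
  qed
  have nonneg: "AE x in ?M. 0 \<le> ?d x"
    using d_eq
  proof eventually_elim
    case (elim x)
    show ?case
      unfolding elim using norm_triangle_ineq[of "weak_grad \<Omega> u x + F x" "weak_grad \<Omega> v x + F x"] by simp
  qed
  have "(\<integral>x. ?d x \<partial>?M) = 0"
    using integral_nonneg_AE[OF nonneg] le0 by linarith
  then have "AE x in ?M. ?d x = 0"
    using integral_nonneg_eq_0_iff_AE[OF d_int nonneg] by blast
  with d_eq show ?thesis
  proof eventually_elim
    case (elim x)
    from trans[OF elim(1)[symmetric] elim(2)] show ?case by simp
  qed
qed

subsection \<open>The map \<open>star\<close>\<close>

text \<open>This is the standard symplectic form. Its antisymmetry makes \<open>star a\<close>
  orthogonal to \<open>a\<close>, and its shape pairs up the mixed partial derivatives in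
  \<open>integral_grad_inner_star\<close>.\<close>

lemma inner_star:
  "a \<bullet> star b = (\<Sum>k\<in>UNIV. a $ (k, False) * b $ (k, True) - a $ (k, True) * b $ (k, False))"
proof -
  have "a \<bullet> star b = (\<Sum>j\<in>UNIV \<times> UNIV. a $ j * star b $ j)"
    by (simp add: inner_vec_def)
  also have "\<dots> = (\<Sum>k\<in>UNIV. \<Sum>t\<in>UNIV. a $ (k, t) * star b $ (k, t))"
    by (simp add: sum.cartesian_product del: UNIV_Times_UNIV)
  also have "\<dots> = (\<Sum>k\<in>UNIV. a $ (k, False) * b $ (k, True) - a $ (k, True) * b $ (k, False))"
    by (simp add: UNIV_bool star_def)
  finally show ?thesis .
qed

lemma inner_star_self: "a \<bullet> star a = 0"
  by (simp add: inner_star mult.commute)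

lemma star_add: "star (a + b) = star a + star b"
  by (simp add: star_def vec_eq_iff)

text \<open>Equality in the triangle inequality means
  \<open>norm a *\<^sub>R b = norm b *\<^sub>R a\<close>. Pairing with \<open>star b\<close> kills
  the left side, and a nonzero \<open>norm b\<close> can be cancelled on the right.\<close>

lemma inner_star_eq_0_if_norm_add_eq:
  assumes "norm (a + b) = norm a + norm b"
  shows "(a - b) \<bullet> star b = 0"
proof (cases "b = 0")
  case True
  then show ?thesis by (simp add: inner_star)
next
  case False
  have "norm a *\<^sub>R b = norm b *\<^sub>R a"
    using assms by (simp add: norm_triangle_eq)
  then have "norm b * (a \<bullet> star b) = norm a * (b \<bullet> star b)"
    by (metis inner_scaleR_left)
  then have "a \<bullet> star b = 0"
    using False by (simp add: inner_star_self)
  then show ?thesis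
    by (simp add: inner_diff_left inner_star_self)
qed

section \<open>Coordinates of gradients and of \<open>star F\<close>\<close>

lemma sum_Basis_eq_sum_axis:
  fixes f :: "real ^ 'n::finite \<Rightarrow> 'b::comm_monoid_add"
  shows "(\<Sum>i\<in>Basis. f i) = (\<Sum>j\<in>UNIV. f (axis j 1))"
proof -
  have *: "(Basis :: (real ^ 'n) set) = range (\<lambda>j. axis j 1)"
    by (auto simp: Basis_vec_def)
  have "inj (\<lambda>j::'n. axis j (1::real))"
    by (auto simp: inj_def axis_eq_axis)
  then show ?thesis
    unfolding * by (simp only: sum.reindex o_def)
qed

lemma weak_grad_nth: "weak_grad \<Omega> u x $ j = weak_partial \<Omega> (axis j 1) u x"
  for u :: "real ^ 'n::finite \<Rightarrow> real"
proof -
  have "weak_grad \<Omega> u x $ j = weak_grad \<Omega> u x \<bullet> axis j 1"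
    by (simp add: cart_eq_inner_axis)
  also have "\<dots> = weak_partial \<Omega> (axis j 1) u x"
    unfolding weak_grad_def by (rule inner_sum_left_Basis) simp
  finally show ?thesis .
qed

lemma W1_vec_nth: "F \<in> W1_vec p \<Omega> \<Longrightarrow> (\<lambda>x. F x $ j) \<in> W1 p \<Omega>"
  unfolding W1_vec_def by (auto simp: cart_eq_inner_axis)

lemma W1_star_nth:
  assumes "open \<Omega>" and F: "F \<in> W1_vec 2 \<Omega>"
  shows "(\<lambda>x. star (F x) $ j) \<in> W1 2 \<Omega>"
proof (cases "snd j")
  case True
  note W = W1_vec_nth[OF F, of "(fst j, False)"]
  show ?thesis
    using W1_2_lincomb[OF \<open>open \<Omega>\<close> W W, of "- 1" 0] True by (simp add: star_def)
next
  case False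
  then show ?thesis
    using W1_vec_nth[OF F, of "(fst j, True)"] by (simp add: star_def)
qed

lemma weak_div_star_Lp_2:
  assumes "open \<Omega>" and "bounded \<Omega>" and F: "F \<in> W1_vec 2 \<Omega>"
  shows "weak_div \<Omega> (\<lambda>y. star (F y)) \<in> Lp 2 \<Omega>"
proof -
  have "(\<lambda>x. \<Sum>j\<in>UNIV. weak_partial \<Omega> (axis j 1) (\<lambda>y. star (F y) $ j) x) \<in> Lp 2 \<Omega>"
    by (intro Lp_2_sum assms W1_weak_partial_Lp W1_star_nth) auto
  then show ?thesis
    by (simp add: weak_div_def[abs_def] sum_Basis_eq_sum_axis cart_eq_inner_axis)
qed

text \<open>The field \<open>star (weak_grad \<Omega> v)\<close> is divergence free because mixed partial derivatives commute.\<close>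

lemma integral_grad_inner_star:
  fixes \<Omega> :: "(real ^ ('n::finite \<times> bool)) set"
  assumes "open \<Omega>" and F: "F \<in> W1_vec 2 \<Omega>" and v: "v \<in> W1 2 \<Omega>"
    and \<psi>: "\<psi> \<in> test_functions \<Omega>"
  shows "(\<integral>x. (\<Sum>j\<in>UNIV. pd (axis j 1) \<psi> x * star (weak_grad \<Omega> v x + F x) $ j) \<partial>lebesgue_on \<Omega>) =
    - (\<integral>x. \<psi> x * weak_div \<Omega> (\<lambda>y. star (F y)) x \<partial>lebesgue_on \<Omega>)"
proof -
  let ?M = "lebesgue_on \<Omega>"
  define e :: "'n \<times> bool \<Rightarrow> real ^ ('n \<times> bool)" where "e j = axis j 1" for j
  have e: "e j \<in> Basis" for j by (simp add: e_def)
  let ?V = "\<lambda>j. weak_partial \<Omega> (e j) v"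
  let ?P = "\<lambda>j. pd (e j) \<psi>"
  let ?S = "\<lambda>j x. star (F x) $ j"
  have P: "?P j \<in> Lp 2 \<Omega>" and V: "?V j \<in> Lp 2 \<Omega>" and S: "?S j \<in> Lp 2 \<Omega>"
    and wS: "weak_partial \<Omega> (e j) (?S j) \<in> Lp 2 \<Omega>" for j
    using test_function_Lp_2[OF \<open>open \<Omega>\<close> test_functions_pd[OF \<psi> e]]
      W1_weak_partial_Lp[OF \<open>open \<Omega>\<close> v e] W1_star_nth[OF \<open>open \<Omega>\<close> F]
      W1_weak_partial_Lp[OF \<open>open \<Omega>\<close> W1_star_nth[OF \<open>open \<Omega>\<close> F] e]
    by (simp_all add: W1_def)
  have \<psi>2: "\<psi> \<in> Lp 2 \<Omega>" by (rule test_function_Lp_2[OF \<open>open \<Omega>\<close> \<psi>])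
  note PV = Lp_2_mult_integrable[OF P V] and PS = Lp_2_mult_integrable[OF P S]
    and \<psi>wS = Lp_2_mult_integrable[OF \<psi>2 wS]
  have split: "(\<Sum>j\<in>UNIV. ?P j x * star (weak_grad \<Omega> v x + F x) $ j) =
      (\<Sum>k\<in>UNIV. ?P (k, False) x * ?V (k, True) x - ?P (k, True) x * ?V (k, False) x) +
      (\<Sum>j\<in>UNIV. ?P j x * ?S j x)" for x
  proof -
    have "(\<Sum>j\<in>UNIV. ?P j x * star (weak_grad \<Omega> v x) $ j) = (\<chi> j. ?P j x) \<bullet> star (weak_grad \<Omega> v x)"
      by (simp add: inner_vec_def)
    also have "\<dots> = (\<Sum>k\<in>UNIV. ?P (k, False) x * ?V (k, True) x - ?P (k, True) x * ?V (k, False) x)"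
      by (simp add: inner_star weak_grad_nth e_def)
    finally show ?thesis
      by (simp add: star_add distrib_left sum.distrib)
  qed
  have "(\<integral>x. (\<Sum>j\<in>UNIV. ?P j x * star (weak_grad \<Omega> v x + F x) $ j) \<partial>?M) =
      (\<Sum>k\<in>UNIV. (\<integral>x. ?P (k, False) x * ?V (k, True) x \<partial>?M) - (\<integral>x. ?P (k, True) x * ?V (k, False) x \<partial>?M)) +
      (\<Sum>j\<in>UNIV. \<integral>x. ?P j x * ?S j x \<partial>?M)"
    unfolding split by (simp add: PV PS)
  \<comment> \<open>For each \<open>k\<close> the two integrals arise from one another by exchanging
    the directions \<open>(k, False)\<close> and \<open>(k, True)\<close>, so they cancel.\<close>
  also have "(\<Sum>k\<in>UNIV. (\<integral>x. ?P (k, False) x * ?V (k, True) x \<partial>?M) - (\<integral>x. ?P (k, True) x * ?V (k, False) x \<partial>?M)) = 0"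
    using integral_pd_weak_partial_swap[OF W1_has_weak_partial[OF v e] W1_has_weak_partial[OF v e] e e \<psi>]
    by simp
  \<comment> \<open>In contrast to the gradient of \<open>v\<close>, the components of
    \<open>star F\<close> have weak derivatives themselves, so each integral is rewritten by
    definition.\<close>
  also have "(\<Sum>j\<in>UNIV. \<integral>x. ?P j x * ?S j x \<partial>?M) =
      (\<Sum>j\<in>UNIV. - (\<integral>x. \<psi> x * weak_partial \<Omega> (e j) (?S j) x \<partial>?M))"
    by (intro sum.cong refl integral_weak_partial_test W1_has_weak_partial[OF W1_star_nth] assms e)
  also have "\<dots> = - (\<integral>x. \<psi> x * (\<Sum>j\<in>UNIV. weak_partial \<Omega> (e j) (?S j) x) \<partial>?M)"
    by (simp add: sum_distrib_left \<psi>wS sum_negf)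
  finally show ?thesis
    by (simp add: weak_div_def sum_Basis_eq_sum_axis cart_eq_inner_axis e_def)
qed

subsection \<open>A bounded nonnegative cutoff\<close>

text \<open>The function t^2 / (1 + t^2), in a form that is easy to differentiate and to
  bound.\<close>

definition cutoff :: "real \<Rightarrow> real" where
  "cutoff t = 1 - inverse (1 + t * t)"

definition cutoff_deriv :: "real \<Rightarrow> real" where
  "cutoff_deriv t = 2 * t * (inverse (1 + t * t) * inverse (1 + t * t))"

lemma one_plus_square_pos: "0 < 1 + t * (t::real)"
  by (simp add: add_pos_nonneg)

lemma cutoff_nonneg: "0 \<le> cutoff t"
  using one_plus_square_pos[of t] by (simp add: cutoff_def field_simps)

lemma cutoff_eq_0_iff: "cutoff t = 0 \<longleftrightarrow> t = 0"
  using one_plus_square_pos[of t] by (simp add: cutoff_def field_simps)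

lemma abs_cutoff_le_1: "\<bar>cutoff t\<bar> \<le> 1"
  using cutoff_nonneg[of t] one_plus_square_pos[of t] by (simp add: cutoff_def)

lemma cutoff_DERIV: "(cutoff has_real_derivative cutoff_deriv t) (at t)"
  unfolding cutoff_def[abs_def] cutoff_deriv_def using one_plus_square_pos[of t]
  by (auto intro!: derivative_eq_intros)

text \<open>With q = 1 + t^2, the numerator satisfies 2 |t| \<le> q \<le> q^2.\<close>

lemma abs_cutoff_deriv_le_1: "\<bar>cutoff_deriv t\<bar> \<le> 1"
proof -
  let ?q = "1 + t * t"
  have q: "0 < ?q" "1 \<le> ?q" by (simp_all add: one_plus_square_pos)
  have "2 * \<bar>t\<bar> \<le> ?q"
    using sum_squares_bound[of 1 "\<bar>t\<bar>"] by (simp add: power2_eq_square)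
  also have "\<dots> \<le> ?q * ?q" using q by (metis mult_left_mono mult.right_neutral less_imp_le)
  finally have "2 * \<bar>t\<bar> * (inverse ?q * inverse ?q) \<le> ?q * ?q * (inverse ?q * inverse ?q)"
    by (rule mult_right_mono) (use q in simp)
  also have "\<dots> = (?q * inverse ?q) * (?q * inverse ?q)" by (simp only: ac_simps)
  also have "\<dots> = 1" by (simp only: right_inverse[OF less_imp_neq[OF q(1), symmetric]] mult_1)
  finally show ?thesis
    using q by (simp add: cutoff_deriv_def abs_mult)
qed

lemma cutoff_lipschitz: "\<bar>cutoff s - cutoff t\<bar> \<le> \<bar>s - t\<bar>"
proof -
  have "norm (cutoff s - cutoff t) \<le> 1 * norm (s - t)"
    by (rule field_differentiable_bound[where S = UNIV and f' = cutoff_deriv])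
       (auto intro: cutoff_DERIV simp: abs_cutoff_deriv_le_1)
  then show ?thesis by simp
qed

lemma continuous_cutoff: "continuous_on UNIV cutoff" "continuous_on UNIV cutoff_deriv"
proof -
  show "continuous_on UNIV cutoff"
    using cutoff_DERIV DERIV_isCont by (blast intro: continuous_at_imp_continuous_on)
  have "1 + t * t \<noteq> 0" for t :: real
    using one_plus_square_pos[of t] by simp
  then show "continuous_on UNIV cutoff_deriv"
    unfolding cutoff_deriv_def[abs_def] by (intro continuous_intros) auto
qed

text \<open>Splitting off one factor \<open>\<phi>\<close> exhibits the composition as a smooth
  function times a test function, which settles smoothness and support together.\<close>

lemma cutoff_test_function:
  assumes "\<phi> \<in> test_functions \<Omega>"
  shows "(\<lambda>x. cutoff (\<phi> x)) \<in> test_functions \<Omega>"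
proof -
  have nz: "1 + \<phi> x * \<phi> x \<noteq> 0" for x
    using one_plus_square_pos[of "\<phi> x"] by simp
  have "(\<lambda>x. (\<phi> x * inverse (1 + \<phi> x * \<phi> x)) * \<phi> x) \<in> test_functions \<Omega>"
    by (intro test_functions_mult[OF assms] Ck_mult Ck_inverse Ck_add Ck_const
        test_functions_Ck[OF assms] nz)
  also have "(\<lambda>x. (\<phi> x * inverse (1 + \<phi> x * \<phi> x)) * \<phi> x) = (\<lambda>x. cutoff (\<phi> x))"
    using nz by (auto simp: cutoff_def fun_eq_iff field_simps)
  finally show ?thesis .
qed

lemma pd_cutoff:
  assumes "\<phi> \<in> test_functions \<Omega>"
  shows "pd i (\<lambda>x. cutoff (\<phi> x)) x = cutoff_deriv (\<phi> x) * pd i \<phi> x"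
  using pd_eqI[OF has_derivative_compose[OF test_functions_has_derivative[OF assms]
        cutoff_DERIV[THEN has_field_derivative_imp_has_derivative]]]
  by simp

text \<open>Passing from \<open>w\<close> to an approximation \<open>\<phi>\<close> costs two
  errors: one in the gradient, paired with \<open>star b\<close>, and one in \<open>cutoff\<close>
  itself, paired with the divergence. The bounds 1 on \<open>cutoff_deriv\<close> and on the
  Lipschitz constant make each at most \<open>\<epsilon>\<close> times a fixed L^2 norm.\<close>

lemma W1_0_AE_eq_0_if_grad_orthogonal_star:
  fixes \<Omega> :: "(real ^ ('n::finite \<times> bool)) set"
  assumes "open \<Omega>" and "bounded \<Omega>"
    and F: "F \<in> W1_vec 2 \<Omega>" and v: "v \<in> W1 2 \<Omega>" and w: "w \<in> W1_0 2 \<Omega>"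
    and pos: "AE x in lebesgue_on \<Omega>. weak_div \<Omega> (\<lambda>y. star (F y)) x > 0"
    and orth: "AE x in lebesgue_on \<Omega>. weak_grad \<Omega> w x \<bullet> star (weak_grad \<Omega> v x + F x) = 0"
  shows "AE x in lebesgue_on \<Omega>. w x = 0"
proof -
  let ?M = "lebesgue_on \<Omega>"
  define \<Delta> where "\<Delta> = weak_div \<Omega> (\<lambda>y. star (F y))"
  define B where "B j x = star (weak_grad \<Omega> v x + F x) $ j" for j x
  define D where "D j = weak_partial \<Omega> (axis j 1) w" for j
  define nrm where "nrm f = sqrt (\<integral>x. (f x)\<^sup>2 \<partial>?M)" for f :: "real ^ ('n \<times> bool) \<Rightarrow> real"
  have W: "w \<in> W1 2 \<Omega>" and w2: "w \<in> Lp 2 \<Omega>" using w by (auto simp: W1_0_def W1_def)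
  have wm: "w \<in> borel_measurable ?M" using w2 by (simp add: Lp_2_iff)
  have \<Delta>: "\<Delta> \<in> Lp 2 \<Omega>"
    unfolding \<Delta>_def by (rule weak_div_star_Lp_2[OF assms(1-3)])
  have D: "D j \<in> Lp 2 \<Omega>" for j
    unfolding D_def by (rule W1_weak_partial_Lp[OF \<open>open \<Omega>\<close> W]) simp
  have B: "B j \<in> Lp 2 \<Omega>" for j
  proof -
    have G: "(\<lambda>x. weak_grad \<Omega> v x $ k + F x $ k) \<in> Lp 2 \<Omega>" for k
      unfolding weak_grad_nth
      by (intro Lp_2_add W1_weak_partial_Lp[OF \<open>open \<Omega>\<close> v])
         (use W1_vec_nth[OF F, of k] in \<open>simp_all add: W1_def\<close>)
    show ?thesis
    proof (cases "snd j")
      case True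
      then have "B j = (\<lambda>x. - 1 * (weak_grad \<Omega> v x $ (fst j, False) + F x $ (fst j, False)))"
        by (simp add: B_def star_def fun_eq_iff)
      with Lp_2_cmult[OF G, of "- 1"] show ?thesis by simp
    next
      case False
      then have "B j = (\<lambda>x. weak_grad \<Omega> v x $ (fst j, True) + F x $ (fst j, True))"
        by (simp add: B_def star_def fun_eq_iff)
      with G show ?thesis by simp
    qed
  qed
  have orth': "AE x in ?M. (\<Sum>j\<in>UNIV. D j x * B j x) = 0"
    using orth by eventually_elim (simp add: inner_vec_def weak_grad_nth D_def B_def)
  have cw_m: "(\<lambda>x. cutoff (w x)) \<in> borel_measurable ?M"
    by (rule measurable_compose[OF wm borel_measurable_continuous_onI[OF continuous_cutoff(1)]])
  have cw: "(\<lambda>x. cutoff (w x)) \<in> Lp 2 \<Omega>"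
    using Lp_2_bounded_mult(1)[OF cw_m abs_cutoff_le_1 Lp_2_const[OF assms(1,2), of 1]] by simp
  have bound: "\<bar>\<integral>x. cutoff (w x) * \<Delta> x \<partial>?M\<bar> \<le> \<epsilon> * (nrm \<Delta> + (\<Sum>j\<in>UNIV. nrm (B j)))"
    if "\<epsilon> > 0" for \<epsilon>
  proof -
    obtain \<phi> where \<phi>: "\<phi> \<in> test_functions \<Omega>"
      and I: "sqrt (\<integral>x. (w x - \<phi> x)\<^sup>2 \<partial>?M) < \<epsilon>"
      and J: "\<forall>i\<in>Basis. sqrt (\<integral>x. (weak_partial \<Omega> i w x - pd i \<phi> x)\<^sup>2 \<partial>?M) < \<epsilon>"
      by (rule W1_0_2_approx[OF \<open>open \<Omega>\<close> w \<open>\<epsilon> > 0\<close>])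
    let ?\<psi> = "\<lambda>x. cutoff (\<phi> x)" and ?\<kappa> = "\<lambda>x. cutoff_deriv (\<phi> x)"
    let ?p = "\<lambda>j. pd (axis j 1) \<phi>"
    have \<phi>2: "\<phi> \<in> Lp 2 \<Omega>" by (rule test_function_Lp_2[OF \<open>open \<Omega>\<close> \<phi>])
    have \<psi>: "?\<psi> \<in> test_functions \<Omega>" by (rule cutoff_test_function[OF \<phi>])
    have \<psi>2: "?\<psi> \<in> Lp 2 \<Omega>" by (rule test_function_Lp_2[OF \<open>open \<Omega>\<close> \<psi>])
    have \<kappa>m: "?\<kappa> \<in> borel_measurable ?M"
      using \<phi>2 by (intro measurable_compose[OF _ borel_measurable_continuous_onI[OF continuous_cutoff(2)]])
        (simp add: Lp_2_iff)
    have p2: "?p j \<in> Lp 2 \<Omega>" for j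
      by (rule test_function_Lp_2[OF \<open>open \<Omega>\<close> test_functions_pd[OF \<phi>]]) simp
    have diff: "(\<lambda>x. D j x - ?p j x) \<in> Lp 2 \<Omega>" for j
      by (rule Lp_2_diff[OF D p2])
    note \<kappa>diff = Lp_2_bounded_mult[OF \<kappa>m abs_cutoff_deriv_le_1 diff]
    have int_j: "integrable ?M (\<lambda>x. ?\<kappa> x * (D j x - ?p j x) * B j x)" for j
      by (rule Lp_2_mult_integrable[OF \<kappa>diff(1) B])
    have int_p: "integrable ?M (\<lambda>x. ?\<kappa> x * ?p j x * B j x)" for j
      by (rule Lp_2_mult_integrable[OF Lp_2_bounded_mult(1)[OF \<kappa>m abs_cutoff_deriv_le_1 p2] B])
    have "(\<integral>x. ?\<psi> x * \<Delta> x \<partial>?M) = - (\<integral>x. (\<Sum>j\<in>UNIV. ?\<kappa> x * ?p j x * B j x) \<partial>?M)"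
      using integral_grad_inner_star[OF \<open>open \<Omega>\<close> F v \<psi>]
      unfolding pd_cutoff[OF \<phi>] by (simp add: \<Delta>_def B_def)
    \<comment> \<open>Subtracting the pointwise identity
      \<open>(\<Sum>j\<in>UNIV. D j x * B j x) = 0\<close> replaces the gradient of
      \<open>\<phi>\<close> by its difference from that of \<open>w\<close>, which is small in
      L^2.\<close>
    also have "(\<integral>x. (\<Sum>j\<in>UNIV. ?\<kappa> x * ?p j x * B j x) \<partial>?M) =
        (\<integral>x. - (\<Sum>j\<in>UNIV. ?\<kappa> x * (D j x - ?p j x) * B j x) \<partial>?M)"
    proof (rule integral_cong_AE)
      show "(\<lambda>x. \<Sum>j\<in>UNIV. ?\<kappa> x * ?p j x * B j x) \<in> borel_measurable ?M"
        by (intro borel_measurable_sum borel_measurable_integrable int_p)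
      show "(\<lambda>x. - (\<Sum>j\<in>UNIV. ?\<kappa> x * (D j x - ?p j x) * B j x)) \<in> borel_measurable ?M"
        by (intro borel_measurable_uminus borel_measurable_sum borel_measurable_integrable int_j)
      show "AE x in ?M. (\<Sum>j\<in>UNIV. ?\<kappa> x * ?p j x * B j x) =
          - (\<Sum>j\<in>UNIV. ?\<kappa> x * (D j x - ?p j x) * B j x)"
        using orth'
      proof eventually_elim
        case (elim x)
        have "(\<Sum>j\<in>UNIV. ?\<kappa> x * (D j x - ?p j x) * B j x) =
            ?\<kappa> x * (\<Sum>j\<in>UNIV. D j x * B j x) - (\<Sum>j\<in>UNIV. ?\<kappa> x * ?p j x * B j x)"
          by (simp add: sum_distrib_left sum_subtractf[symmetric] algebra_simps)
        with elim show ?case by simp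
      qed
    qed
    also have "- \<dots> = (\<Sum>j\<in>UNIV. \<integral>x. ?\<kappa> x * (D j x - ?p j x) * B j x \<partial>?M)"
      by (simp add: int_j)
    finally have "\<bar>\<integral>x. ?\<psi> x * \<Delta> x \<partial>?M\<bar> \<le> (\<Sum>j\<in>UNIV. \<bar>\<integral>x. ?\<kappa> x * (D j x - ?p j x) * B j x \<partial>?M\<bar>)"
      by (simp only: sum_abs)
    also have "\<dots> \<le> (\<Sum>j\<in>UNIV. \<epsilon> * nrm (B j))"
    proof (rule sum_mono)
      fix j :: "'n \<times> bool"
      have "\<bar>\<integral>x. ?\<kappa> x * (D j x - ?p j x) * B j x \<partial>?M\<bar> \<le>
          sqrt (\<integral>x. (?\<kappa> x * (D j x - ?p j x))\<^sup>2 \<partial>?M) * nrm (B j)"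
        unfolding nrm_def by (rule Cauchy_Schwarz_Lp_2[OF \<kappa>diff(1) B])
      also have "\<dots> \<le> \<epsilon> * nrm (B j)"
      proof (rule mult_right_mono)
        have "sqrt (\<integral>x. (?\<kappa> x * (D j x - ?p j x))\<^sup>2 \<partial>?M) \<le> sqrt (\<integral>x. (D j x - ?p j x)\<^sup>2 \<partial>?M)"
          using \<kappa>diff(2)[of j] by (intro real_sqrt_le_mono) simp
        also have "\<dots> < \<epsilon>"
          using bspec[OF J, of "axis j 1"] by (simp add: D_def)
        finally show "sqrt (\<integral>x. (?\<kappa> x * (D j x - ?p j x))\<^sup>2 \<partial>?M) \<le> \<epsilon>" by simp
      qed (simp add: nrm_def)
      finally show "\<bar>\<integral>x. ?\<kappa> x * (D j x - ?p j x) * B j x \<partial>?M\<bar> \<le> \<epsilon> * nrm (B j)" .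
    qed
    finally have 1: "\<bar>\<integral>x. ?\<psi> x * \<Delta> x \<partial>?M\<bar> \<le> \<epsilon> * (\<Sum>j\<in>UNIV. nrm (B j))"
      by (simp add: sum_distrib_left)
    have c\<psi>: "(\<lambda>x. cutoff (w x) - ?\<psi> x) \<in> Lp 2 \<Omega>"
      by (rule Lp_2_diff[OF cw \<psi>2])
    \<comment> \<open>The second error: since \<open>cutoff\<close> is 1-Lipschitz, its L^2 distance
      is at most that of \<open>w\<close> and \<open>\<phi>\<close>.\<close>
    have "(\<integral>x. cutoff (w x) * \<Delta> x \<partial>?M) - (\<integral>x. ?\<psi> x * \<Delta> x \<partial>?M) = (\<integral>x. (cutoff (w x) - ?\<psi> x) * \<Delta> x \<partial>?M)"
      by (simp add: left_diff_distrib Lp_2_mult_integrable[OF cw \<Delta>] Lp_2_mult_integrable[OF \<psi>2 \<Delta>])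
    also have "\<bar>\<dots>\<bar> \<le> sqrt (\<integral>x. (cutoff (w x) - ?\<psi> x)\<^sup>2 \<partial>?M) * nrm \<Delta>"
      unfolding nrm_def by (rule Cauchy_Schwarz_Lp_2[OF c\<psi> \<Delta>])
    also have "\<dots> \<le> \<epsilon> * nrm \<Delta>"
    proof (rule mult_right_mono)
      have "(\<integral>x. (cutoff (w x) - ?\<psi> x)\<^sup>2 \<partial>?M) \<le> (\<integral>x. (w x - \<phi> x)\<^sup>2 \<partial>?M)"
      proof (rule integral_mono)
        show "integrable ?M (\<lambda>x. (cutoff (w x) - ?\<psi> x)\<^sup>2)" "integrable ?M (\<lambda>x. (w x - \<phi> x)\<^sup>2)"
          using c\<psi> Lp_2_diff[OF w2 \<phi>2] by (simp_all add: Lp_2_iff)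
        show "(cutoff (w x) - ?\<psi> x)\<^sup>2 \<le> (w x - \<phi> x)\<^sup>2" for x
          using cutoff_lipschitz[of "w x" "\<phi> x"] by (simp add: abs_le_square_iff)
      qed
      then show "sqrt (\<integral>x. (cutoff (w x) - ?\<psi> x)\<^sup>2 \<partial>?M) \<le> \<epsilon>"
        using I by (meson less_imp_le order_trans real_sqrt_le_mono)
    qed (simp add: nrm_def)
    finally show ?thesis
      using 1 by (simp add: distrib_left)
  qed
  have zero: "(\<integral>x. cutoff (w x) * \<Delta> x \<partial>?M) = 0"
  proof -
    \<comment> \<open>The summand 1 guarantees \<open>N > 0\<close>, so that
      \<open>\<epsilon> / N\<close> is a legitimate accuracy; the resulting bound
      \<open>\<epsilon> / N * (N - 1)\<close> is at most \<open>\<epsilon>\<close>.\<close>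
    define N where "N = nrm \<Delta> + (\<Sum>j\<in>UNIV. nrm (B j)) + 1"
    have N: "N > 0"
      by (simp add: N_def nrm_def sum_nonneg add_nonneg_pos)
    have "\<bar>\<integral>x. cutoff (w x) * \<Delta> x \<partial>?M\<bar> \<le> 0 + \<epsilon>" if "\<epsilon> > 0" for \<epsilon>
    proof -
      have "\<bar>\<integral>x. cutoff (w x) * \<Delta> x \<partial>?M\<bar> \<le> \<epsilon> / N * (N - 1)"
        using bound[of "\<epsilon> / N"] N that by (simp add: N_def)
      also have "\<dots> \<le> \<epsilon>"
        using N that by (simp add: field_simps)
      finally show ?thesis by simp
    qed
    then have "\<bar>\<integral>x. cutoff (w x) * \<Delta> x \<partial>?M\<bar> \<le> 0"
      by (rule field_le_epsilon)
    then show ?thesis by simp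
  qed
  \<comment> \<open>A nonnegative integrand with zero integral vanishes almost everywhere, and as
    \<open>\<Delta>\<close> is positive the factor \<open>cutoff (w x)\<close> must be zero.\<close>
  have nonneg: "AE x in ?M. 0 \<le> cutoff (w x) * \<Delta> x"
    using pos unfolding \<Delta>_def by eventually_elim (simp add: cutoff_nonneg)
  have "AE x in ?M. cutoff (w x) * \<Delta> x = 0"
    using zero integral_nonneg_eq_0_iff_AE[OF Lp_2_mult_integrable[OF cw \<Delta>] nonneg] by blast
  then show ?thesis
    using pos unfolding \<Delta>_def by eventually_elim (simp add: cutoff_eq_0_iff)
qed

theorem theoremB:
  fixes \<Omega> :: "(real ^ ('n::finite \<times> bool)) set"
    and F :: "real ^ ('n \<times> bool) \<Rightarrow> real ^ ('n \<times> bool)"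
    and H u v :: "real ^ ('n \<times> bool) \<Rightarrow> real"
  assumes "open \<Omega>" and "connected \<Omega>" and "\<Omega> \<noteq> {}" and "bounded \<Omega>"
    and "H \<in> Linf \<Omega>"
    and "F \<in> W1_vec 2 \<Omega>"
    and "AE x in lebesgue_on \<Omega>. weak_div \<Omega> (\<lambda>y. star (F y)) x > 0"
    and "u \<in> W1 2 \<Omega>" and "v \<in> W1 2 \<Omega>"
    and "minimizer \<Omega> F H u" and "minimizer \<Omega> F H v"
    and "(\<lambda>x. u x - v x) \<in> W1_0 2 \<Omega>"
  shows "AE x in lebesgue_on \<Omega>. u x = v x"
proof -
  have eq: "AE x in lebesgue_on \<Omega>. norm ((weak_grad \<Omega> u x + F x) + (weak_grad \<Omega> v x + F x)) =
      norm (weak_grad \<Omega> u x + F x) + norm (weak_grad \<Omega> v x + F x)"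
    using minimizers_norm_add_eq[OF assms(1,4,5,6,8-12)] .
  have "AE x in lebesgue_on \<Omega>. weak_grad \<Omega> (\<lambda>x. u x - v x) x \<bullet> star (weak_grad \<Omega> v x + F x) = 0"
    using eq weak_grad_lincomb_AE[OF assms(1,8,9), of 1 "- 1"]
  proof eventually_elim
    case (elim x)
    \<comment> \<open>\<open>F\<close> cancels in the difference, so the gradient of
      \<open>u - v\<close> has the form \<open>a - b\<close> for the two fields of
      \<open>eq\<close>.\<close>
    have "weak_grad \<Omega> (\<lambda>x. u x - v x) x = (weak_grad \<Omega> u x + F x) - (weak_grad \<Omega> v x + F x)"
      using elim(2) by simp
    then show ?case
      using inner_star_eq_0_if_norm_add_eq[OF elim(1)] by simp
  qed
  from W1_0_AE_eq_0_if_grad_orthogonal_star[OF assms(1,4,6,9,12,7) this] show ?thesis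
    by eventually_elim simp
qed

end
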